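(* Let $q$ be a power of the prime $p$ and let $P(X)=\sum_{n\ge 1}p_nX^n\in\mathcal{O}_{\mathbf{C}_p}[\![X]\!]$ be an LT-like power series of Weierstrass degree $q$. Then the set $\Lambda(P)=\{z\in D : P^{\circ n}(z)=0 \text{ for some } n\ge 0\}$ is an analytic boundary.
   Context: $\mathbf{C}_p$ is the completion of an algebraic closure of $\mathbf{Q}_p$, $\operatorname{val}_p$ is the $p$-adic valuation normalized by $\operatorname{val}_p(p)=1$, $|\cdot|$ the corresponding absolute value, $\mathcal{O}_{\mathbf{C}_p}$ the valuation ring and $D=\mathfrak{m}_{\mathbf{C}_p}$ the open unit disk. An LT-like power series (of Weierstrass degree $q$) is $P(X)=\sum_{n\ge1}p_nX^n\in\mathcal{O}_{\mathbf{C}_p}[\![X]\!]$ with $0<\operatorname{val}_p(p_1)\le 1$, $p_q\in\mathcal{O}_{\mathbf{C}_p}^\times$, and $P(X)\equiv p_qX^q \bmod p_1\mathcal{O}_{\mathbf{C}_p}[\![X]\!]$. $P^{\circ n}$ is the $n$-fold composite ($P^{\circ 0}=X$). Let $\mathcal{E}^+_{\mathbf{C}_p}=\mathbf{C}_p\otimes_{\mathcal{O}_{\mathbf{C}_p}}\mathcal{O}_{\mathbf{C}_p}[\![X]\!]$ (bounded holomorphic functions on $D$), and for $f\in\mathcal{E}^+_{\mathbf{C}_p}$ and $S\subset D$ let $\|f\|_S=\sup_{z\in S}|f(z)|$. A subset $A\subset D$ is an analytic boundary if it can be written as $A=\{a_n\}_{n\ge1}$ with $|a_n|\to 1$ as $n\to+\infty$,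 and $\|f\|_D=\|f\|_A$ for every $f\in\mathcal{E}^+_{\mathbf{C}_p}$. *)

theory Defs
  imports "HOL-Analysis.Analysis" "HOL-Computational_Algebra.Computational_Algebra"
begin

(* Fields of characteristic 0 with a non-archimedean absolute value; topology, limits and
   closures are those of the metric absval (x - y). Definiteness and nonnegativity of absval
   come from the metric space axioms. The library's norm is constrained to real vector
   spaces and therefore cannot be used here. *)
class nonarch_field = field_char_0 + metric_space +
  fixes absval :: "'a \<Rightarrow> real"
  assumes dist_absval: "dist x y = absval (x - y)"
    and absval_mult: "absval (x * y) = absval x * absval y"
    and absval_ultrametric: "absval (x + y) \<le> max (absval x) (absval y)"

definition algebraic_elements_over :: "'a::field set \<Rightarrow> 'a set" where
  "algebraic_elements_over F =
     {x. \<exists>f::'a poly. f \<noteq> 0 \<and> (\<forall>i. coeff f i \<in> F) \<and> poly f x = 0}"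

definition algebraically_closed_subset :: "'a::field set \<Rightarrow> bool" where
  "algebraically_closed_subset L \<longleftrightarrow>
     (\<forall>f::'a poly. (\<forall>i. coeff f i \<in> L) \<and> degree f > 0 \<longrightarrow> (\<exists>x\<in>L. poly f x = 0))"

(* The closure of the rationals. In a field satisfying is_Cp below, the absolute value
   restricts to the p-adic one on the rationals (it is ultrametric with absval p = 1/p) and
   the field is complete, so this closure is the completion of the rationals at p. *)
definition Qp :: "'a::nonarch_field set" where
  "Qp = closure \<rat>"

definition Qp_bar :: "'a::nonarch_field set" where
  "Qp_bar = algebraic_elements_over Qp"

(* The type 'a, with its absolute value, is the completion of an algebraic closure of the
   p-adic numbers: it is complete, and Qp_bar, the set of its elements algebraic over Qp,
   is algebraically closed (hence an algebraic closure of Qp) and dense. *)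
definition is_Cp :: "nat \<Rightarrow> 'a::nonarch_field itself \<Rightarrow> bool" where
  "is_Cp p _ \<longleftrightarrow>
     absval (of_nat p :: 'a) = 1 / real p \<and>
     algebraically_closed_subset (Qp_bar :: 'a set) \<and>
     closure (Qp_bar :: 'a set) = UNIV \<and>
     complete (UNIV :: 'a set)"

definition val :: "nat \<Rightarrow> 'a::nonarch_field \<Rightarrow> ereal" where
  "val p x = (if x = 0 then \<infinity> else ereal (- log (real p) (absval x)))"

definition val_ring :: "'a::nonarch_field set" where
  "val_ring = {x. absval x \<le> 1}"

definition val_ring_units :: "'a::nonarch_field set" where
  "val_ring_units = {x \<in> val_ring. \<exists>y\<in>val_ring. x * y = 1}"

definition open_disk :: "'a::nonarch_field set" where
  "open_disk = {z. absval z < 1}"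

definition integral_fps :: "'a::nonarch_field fps set" where
  "integral_fps = {f. \<forall>n. fps_nth f n \<in> val_ring}"

definition LT_like :: "nat \<Rightarrow> nat \<Rightarrow> 'a::nonarch_field fps \<Rightarrow> bool" where
  "LT_like p q P \<longleftrightarrow>
     P \<in> integral_fps \<and> fps_nth P 0 = 0 \<and>
     0 < val p (fps_nth P 1) \<and> val p (fps_nth P 1) \<le> 1 \<and>
     fps_nth P q \<in> val_ring_units \<and>
     (\<exists>G\<in>integral_fps.
        P - fps_const (fps_nth P q) * fps_X ^ q = fps_const (fps_nth P 1) * G)"

definition fps_iterate :: "'a::comm_ring_1 fps \<Rightarrow> nat \<Rightarrow> 'a fps" where
  "fps_iterate P n = ((\<lambda>F. P oo F) ^^ n) fps_X"

(* The library's eval_fps requires a real normed algebra. *)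
definition fps_value :: "'a::nonarch_field fps \<Rightarrow> 'a \<Rightarrow> 'a" where
  "fps_value f z = (\<Sum>n. fps_nth f n * z ^ n)"

(* The tensor product of the field with the integral power series over the valuation ring,
   viewed inside the power series over the field: a finite sum of terms c * g has this
   form again, since all the scalars c are integral multiples of one of them. *)
definition bounded_fps :: "'a::nonarch_field fps set" where
  "bounded_fps = {fps_const c * g | c g. g \<in> integral_fps}"

(* Only used for f in bounded_fps and nonempty subsets S of open_disk, where the set of
   values is nonempty and bounded above, so that the real supremum is meaningful. *)
definition sup_norm_on :: "'a::nonarch_field set \<Rightarrow> 'a fps \<Rightarrow> real" where
  "sup_norm_on S f = (SUP z\<in>S. absval (fps_value f z))"

definition analytic_boundary :: "'a::nonarch_field set \<Rightarrow> bool" where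
  "analytic_boundary A \<longleftrightarrow>
     A \<subseteq> open_disk \<and>
     (\<exists>a :: nat \<Rightarrow> 'a. A = a ` {1..} \<and> (\<lambda>n. absval (a n)) \<longlonglongrightarrow> 1) \<and>
     (\<forall>f\<in>bounded_fps. sup_norm_on open_disk f = sup_norm_on A f)"

definition Lambda_set :: "'a::nonarch_field fps \<Rightarrow> 'a set" where
  "Lambda_set P = {z \<in> open_disk. \<exists>n. fps_value (fps_iterate P n) z = 0}"

end

theory Submission
  imports Defs
begin

text \<open>
  Let \<open>c = absval (fps_nth P 1)\<close>, and let \<open>Z n\<close> be the set of zeros of the \<open>n\<close>-th iterate of \<open>P\<close>
  in the open disk. Since \<open>P' = P' 0 * (1 + ...)\<close> has constant absolute value \<open>c\<close> on the disk, these
  zeros are simple, \<open>P\<^sup>n\<close> has the absolute value of \<open>\<Prod>w\<in>Z n. (X - w)\<close>, and the derivative of this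
  polynomial at each of its zeros has absolute value \<open>c ^ n\<close>. If \<open>f\<close> is bounded by \<open>S\<close> on the disk and by \<open>M\<close>
  on all the \<open>Z n\<close>, Lagrange interpolation of \<open>f ^ (k * n)\<close> at \<open>Z n\<close> gives
  \<open>absval (f z) ^ (k * n) \<le> max (S ^ (k * n) * absval (P\<^sup>n z)) (M ^ (k * n) / c ^ n)\<close>, where
  \<open>absval (P\<^sup>n z) \<le> C * c ^ n\<close> with \<open>C\<close> depending on \<open>z\<close>. If \<open>M < S\<close>, one can choose \<open>k\<close> with
  \<open>(M / S) ^ k < c\<^sup>2\<close>; letting \<open>n\<close> tend to infinity yields \<open>absval (f z) ^ k \<le> S ^ k * c\<close> for every \<open>z\<close>,
  which contradicts the choice of \<open>S\<close> as the supremum.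
\<close>

section \<open>The absolute value\<close>

lemma absval_0 [simp]: "absval (0::'a::nonarch_field) = 0"
  using dist_absval[of "0::'a" 0] by simp

lemma absval_eq_0_iff [simp]: "absval (x::'a::nonarch_field) = 0 \<longleftrightarrow> x = 0"
  using dist_absval[of x 0] by (metis diff_zero dist_eq_0_iff)

lemma absval_nonneg [simp]: "0 \<le> absval (x::'a::nonarch_field)"
  using dist_absval[of x 0] by (metis diff_zero zero_le_dist)

lemma absval_pos_iff [simp]: "0 < absval (x::'a::nonarch_field) \<longleftrightarrow> x \<noteq> 0"
  using absval_nonneg[of x] absval_eq_0_iff[of x] by linarith

lemma absval_not_neg [simp]: "\<not> absval (x::'a::nonarch_field) < 0"
  by (simp add: not_less)

lemma absval_1 [simp]: "absval (1::'a::nonarch_field) = 1"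
  using absval_mult[of "1::'a" 1] absval_eq_0_iff[of "1::'a"] by simp

lemma absval_minus [simp]: "absval (- x) = absval (x::'a::nonarch_field)"
  using dist_absval[of x 0] dist_absval[of 0 x] by (simp add: dist_commute)

lemma absval_minus_commute: "absval (x - y) = absval (y - x :: 'a::nonarch_field)"
  by (metis absval_minus minus_diff_eq)

lemma absval_power: "absval (x ^ n) = absval (x::'a::nonarch_field) ^ n"
  by (induction n) (auto simp: absval_mult)

lemma absval_prod: "absval (\<Prod>i\<in>A. f i) = (\<Prod>i\<in>A. absval (f i :: 'a::nonarch_field))"
  by (induction A rule: infinite_finite_induct) (auto simp: absval_mult)

lemma absval_divide: "absval (x / y) = absval x / absval (y::'a::nonarch_field)"
proof (cases "y = 0")
  case False
  then have "absval x = absval (x / y) * absval y"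
    by (metis absval_mult nonzero_eq_divide_eq)
  with False show ?thesis by (simp add: field_simps)
qed auto

lemma absval_add_le:
  "absval x \<le> B \<Longrightarrow> absval y \<le> B \<Longrightarrow> absval (x + y :: 'a::nonarch_field) \<le> B"
  using absval_ultrametric[of x y] by linarith

lemma absval_diff_le:
  "absval x \<le> B \<Longrightarrow> absval y \<le> B \<Longrightarrow> absval (x - y :: 'a::nonarch_field) \<le> B"
  using absval_add_le[of x B "- y"] by simp

lemma absval_add_less:
  "absval x < B \<Longrightarrow> absval y < B \<Longrightarrow> absval (x + y :: 'a::nonarch_field) < B"
  using absval_ultrametric[of x y] by linarith

lemma absval_diff_less:
  "absval x < B \<Longrightarrow> absval y < B \<Longrightarrow> absval (x - y :: 'a::nonarch_field) < B"
  using absval_add_less[of x B "- y"] by simp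

text \<open>If \<open>absval (x + y)\<close> were below \<open>absval x\<close>, then
  \<open>x = (x + y) - y\<close> would be a difference of two elements of strictly smaller absolute
  value.\<close>

lemma absval_add_eq:
  assumes "absval y < absval (x::'a::nonarch_field)"
  shows "absval (x + y) = absval x"
  using absval_add_le[of x "absval x" y] absval_diff_less[of "x + y" "absval x" y] assms
  by fastforce

lemma absval_eq_of_diff_less:
  assumes "absval (x - y) < absval (y::'a::nonarch_field)"
  shows "absval x = absval y"
  using absval_add_eq[OF assms] by simp

lemma absval_sum_le:
  assumes "\<And>i. i \<in> A \<Longrightarrow> absval (f i :: 'a::nonarch_field) \<le> B" "0 \<le> B"
  shows "absval (\<Sum>i\<in>A. f i) \<le> B"
  using assms by (induction A rule: infinite_finite_induct) (auto intro: absval_add_le)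

lemma absval_of_nat_le: "absval (of_nat n :: 'a::nonarch_field) \<le> 1"
  by (induction n) (auto intro: absval_add_le)

lemma tendsto_absval_iff:
  "(f \<longlongrightarrow> (l::'a::nonarch_field)) F \<longleftrightarrow> ((\<lambda>n. absval (f n - l)) \<longlongrightarrow> 0) F"
  by (subst tendsto_dist_iff) (simp add: dist_absval)

section \<open>Continuity of the field operations\<close>

instance nonarch_field \<subseteq> topological_ab_group_add
proof
  fix a b :: 'a
  show "((\<lambda>x. fst x + snd x) \<longlongrightarrow> a + b) (nhds a \<times>\<^sub>F nhds b)"
    unfolding tendsto_iff
  proof (intro allI impI)
    fix e :: real assume "0 < e"
    then have "\<forall>\<^sub>F x in nhds a \<times>\<^sub>F nhds b. dist (fst x) a < e \<and> dist (snd x) b < e"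
      by (intro eventually_prodI[where P = "\<lambda>x. dist x a < e" and Q = "\<lambda>x. dist x b < e", THEN eventually_mono])
         (auto simp: eventually_nhds_metric)
    then show "\<forall>\<^sub>F x in nhds a \<times>\<^sub>F nhds b. dist (fst x + snd x) (a + b) < e"
    proof (rule eventually_mono)
      fix x :: "'a \<times> 'a" assume "dist (fst x) a < e \<and> dist (snd x) b < e"
      then have "absval ((fst x - a) + (snd x - b)) < e"
        by (intro absval_add_less) (auto simp: dist_absval)
      then show "dist (fst x + snd x) (a + b) < e"
        by (simp add: dist_absval algebra_simps)
    qed
  qed
  have "dist (- x) (- a) = dist x a" for x :: 'a
    by (simp add: dist_absval absval_minus_commute)
  then show "(uminus \<longlongrightarrow> - a) (nhds a)"
    by (auto simp: tendsto_iff eventually_nhds_metric)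
qed

instance nonarch_field \<subseteq> topological_semigroup_mult
proof
  fix a b :: 'a
  show "((\<lambda>x. fst x * snd x) \<longlongrightarrow> a * b) (nhds a \<times>\<^sub>F nhds b)"
    unfolding tendsto_iff
  proof (intro allI impI)
    fix e :: real assume e: "0 < e"
    \<comment> \<open>The product is compared through
      \<open>x * y - a * b = (x - a) * y + (y - b) * a\<close>. Here \<open>C\<close> bounds
      \<open>a\<close> and \<open>b\<close>, and also every \<open>y\<close> within
      \<open>d \<le> 1 \<le> C\<close> of \<open>b\<close>, by the ultrametric inequality.\<close>
    define C where "C = 1 + absval a + absval b"
    have C: "C \<ge> 1" "absval a \<le> C" "absval b \<le> C"
      using absval_nonneg[of a] absval_nonneg[of b] by (auto simp: C_def)
    define d where "d = min 1 (e / C)"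
    have d: "d > 0" "d \<le> 1" "d * C \<le> e"
      using C e by (auto simp: d_def field_simps min_def)
    have "\<forall>\<^sub>F x in nhds a \<times>\<^sub>F nhds b. dist (fst x) a < d \<and> dist (snd x) b < d"
      using d by (intro eventually_prodI[where P = "\<lambda>x. dist x a < d" and Q = "\<lambda>x. dist x b < d", THEN eventually_mono])
         (auto simp: eventually_nhds_metric)
    then show "\<forall>\<^sub>F x in nhds a \<times>\<^sub>F nhds b. dist (fst x * snd x) (a * b) < e"
    proof (rule eventually_mono)
      fix x :: "'a \<times> 'a" assume x: "dist (fst x) a < d \<and> dist (snd x) b < d"
      have *: "absval (u * v) < e" if "absval u < d" "absval v \<le> C" for u v :: 'a
      proof -
        have "absval (u * v) \<le> absval u * C"
          using that by (simp add: absval_mult mult_left_mono)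
        also have "\<dots> < d * C" using that C by (intro mult_strict_right_mono) auto
        finally show ?thesis using d by simp
      qed
      have s: "absval (snd x) \<le> C"
        using absval_add_le[of "snd x - b" C b] x C d by (simp add: dist_absval)
      have "absval ((fst x - a) * snd x + (snd x - b) * a) < e"
        using x s C by (intro absval_add_less *) (auto simp: dist_absval)
      then show "dist (fst x * snd x) (a * b) < e"
        by (simp add: dist_absval algebra_simps)
    qed
  qed
qed

section \<open>Bounded power series on the open unit disk\<close>

text \<open>A bound on the Gauss norm of \<open>f\<close>. Carrying the bound \<open>B\<close> as a
  parameter lets estimates be chained without forming a supremum over the coefficients.\<close>

definition coeffs_le :: "real \<Rightarrow> 'a::nonarch_field fps \<Rightarrow> bool" where
  "coeffs_le B f \<longleftrightarrow> (\<forall>n. absval (fps_nth f n) \<le> B)"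

lemma coeffs_leD: "coeffs_le B f \<Longrightarrow> absval (fps_nth f n) \<le> B"
  by (simp add: coeffs_le_def)

lemma coeffs_le_nonneg: "coeffs_le B f \<Longrightarrow> 0 \<le> B"
  by (meson absval_nonneg coeffs_leD order_trans)

lemma coeffs_le_mono: "coeffs_le B f \<Longrightarrow> B \<le> C \<Longrightarrow> coeffs_le C f"
  by (meson coeffs_le_def order_trans)

lemma coeffs_le_1_iff: "coeffs_le 1 f \<longleftrightarrow> f \<in> integral_fps"
  by (simp add: coeffs_le_def integral_fps_def val_ring_def)

lemma coeffs_le_add: "coeffs_le B f \<Longrightarrow> coeffs_le B g \<Longrightarrow> coeffs_le B (f + g)"
  by (simp add: coeffs_le_def absval_add_le)

lemma coeffs_le_diff: "coeffs_le B f \<Longrightarrow> coeffs_le B g \<Longrightarrow> coeffs_le B (f - g)"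
  by (simp add: coeffs_le_def absval_diff_le)

lemma coeffs_le_const: "absval c \<le> B \<Longrightarrow> coeffs_le B (fps_const c)"
  using absval_nonneg[of c] unfolding coeffs_le_def
  by (metis absval_0 fps_nth_fps_const order_trans)

lemma coeffs_le_X: "coeffs_le 1 fps_X"
  by (simp add: coeffs_le_def fps_X_def)

lemma coeffs_le_mult:
  assumes "coeffs_le B f" "coeffs_le C g"
  shows "coeffs_le (B * C) (f * g)"
  unfolding coeffs_le_def fps_mult_nth
  using assms
  by (auto intro!: absval_sum_le mult_mono mult_nonneg_nonneg intro: coeffs_leD coeffs_le_nonneg
      simp: absval_mult)

lemma coeffs_le_mult_1: "coeffs_le B f \<Longrightarrow> coeffs_le 1 g \<Longrightarrow> coeffs_le B (f * g)"
  using coeffs_le_mult[of B f 1 g] by simp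

lemma coeffs_le_power: "coeffs_le B f \<Longrightarrow> coeffs_le (B ^ n) (f ^ n)"
  by (induction n) (auto simp: coeffs_le_mult, simp add: coeffs_le_def)

lemma coeffs_le_prod_1: "(\<And>i. i \<in> A \<Longrightarrow> coeffs_le 1 (f i)) \<Longrightarrow> coeffs_le 1 (\<Prod>i\<in>A. f i)"
  by (induction A rule: infinite_finite_induct)
     (auto simp: coeffs_le_mult_1, simp_all add: coeffs_le_def)

lemma coeffs_le_sum:
  assumes "\<And>i. i \<in> A \<Longrightarrow> coeffs_le B (f i)" "0 \<le> B"
  shows "coeffs_le B (\<Sum>i\<in>A. f i)"
  using assms by (induction A rule: infinite_finite_induct) (auto simp: coeffs_le_add, simp_all add: coeffs_le_def)

lemma coeffs_le_shift: "coeffs_le B f \<Longrightarrow> coeffs_le B (fps_shift n f)"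
  by (simp add: coeffs_le_def)

lemma coeffs_le_X_minus_const: "absval w \<le> 1 \<Longrightarrow> coeffs_le 1 (fps_X - fps_const w)"
  by (intro coeffs_le_diff coeffs_le_X coeffs_le_const)

lemma coeffs_le_compose:
  assumes "coeffs_le B f" "coeffs_le 1 g"
  shows "coeffs_le B (f oo g)"
proof -
  have "absval (fps_nth f i * fps_nth (g ^ i) n) \<le> B" for i n
  proof -
    have "absval (fps_nth f i) * absval (fps_nth (g ^ i) n) \<le> B * 1"
      using assms coeffs_le_power[of 1 g i]
      by (intro mult_mono coeffs_leD coeffs_le_nonneg[of B f]) auto
    then show ?thesis by (simp add: absval_mult)
  qed
  then show ?thesis
    using coeffs_le_nonneg[OF assms(1)]
    by (auto simp: coeffs_le_def fps_compose_nth intro!: absval_sum_le)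
qed

lemma fps_const_plus_X_mult_shift:
  "fps_const (fps_nth f 0) + fps_X * fps_shift 1 f = (f :: 'a::comm_ring_1 fps)"
  by (rule fps_ext) (simp add: fps_X_mult_nth del: One_nat_def)

text \<open>Away from \<open>0\<close> the absolute value is locally constant: a term closer to
  \<open>l\<close> than \<open>absval l\<close> has the same absolute value as
  \<open>l\<close>.\<close>

lemma LIMSEQ_absval_le:
  assumes "s \<longlonglongrightarrow> (l :: 'a::nonarch_field)" "\<And>n. absval (s n) \<le> B"
  shows "absval l \<le> B"
proof (rule ccontr)
  assume "\<not> absval l \<le> B"
  moreover have "0 \<le> B" using assms(2) absval_nonneg order_trans by blast
  ultimately have "0 < absval l" and l: "B < absval l" by auto
  then have "\<forall>\<^sub>F n in sequentially. dist (s n) l < absval l"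
    using assms(1) tendsto_iff by blast
  then obtain n where "dist (s n) l < absval l"
    by (auto simp: eventually_sequentially)
  then have "absval (s n) = absval l"
    by (intro absval_eq_of_diff_less) (simp add: dist_absval)
  with l assms(2)[of n] show False by simp
qed

locale complete_nonarch =
  fixes ty :: "'a::nonarch_field itself"
  assumes complete_ty: "complete (UNIV :: 'a set)"
begin

text \<open>A telescoping sum is bounded by its largest step, so in an ultrametric space small
  consecutive steps already make a sequence Cauchy.\<close>

lemma convergent_if_steps_tendsto_0:
  fixes s :: "nat \<Rightarrow> 'a"
  assumes "\<And>n. absval (s (Suc n) - s n) \<le> e n" "e \<longlonglongrightarrow> 0"
  shows "convergent s"
proof -
  have "Cauchy s"
    unfolding Cauchy_altdef2
  proof (intro allI impI)
    fix d :: real assume "d > 0"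
    then obtain N where N: "\<And>n. n \<ge> N \<Longrightarrow> e n < d"
      using order_tendstoD(2)[OF assms(2)] unfolding eventually_sequentially by blast
    have "absval (s n - s N) < d" if "n \<ge> N" for n
      using that
    proof (induction n rule: dec_induct)
      case base
      with \<open>d > 0\<close> show ?case by simp
    next
      case (step n)
      have "absval ((s (Suc n) - s n) + (s n - s N)) < d"
        using step assms(1)[of n] N[of n] by (intro absval_add_less) auto
      then show ?case by simp
    qed
    then show "\<exists>N. \<forall>n\<ge>N. dist (s n) (s N) < d"
      by (auto simp: dist_absval)
  qed
  with complete_ty show ?thesis
    unfolding complete_def convergent_def by blast
qed

text \<open>Subtracting the constant term and dividing by \<open>X\<close> turns the defect \<open>E f\<close> into
  \<open>w * E (fps_shift 1 f)\<close>; iterating shows that it vanishes.\<close>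

lemma shift_defect_eq_0:
  fixes E :: "'a fps \<Rightarrow> 'a"
  assumes step: "\<And>f. coeffs_le B f \<Longrightarrow> E f = w * E (fps_shift 1 f)"
    and bound: "\<And>f. coeffs_le B f \<Longrightarrow> absval (E f) \<le> C"
    and w: "absval w < 1" and f: "coeffs_le B f"
  shows "E f = 0"
proof -
  have "absval (E f) \<le> absval w ^ n * C" if "coeffs_le B f" for n f
    using that
  proof (induction n arbitrary: f)
    case (Suc n)
    have "absval w * absval (E (fps_shift 1 f)) \<le> absval w * (absval w ^ n * C)"
      using Suc.IH[OF coeffs_le_shift[OF Suc.prems]] by (intro mult_left_mono) auto
    then show ?case
      using step[OF Suc.prems] by (simp add: absval_mult mult.assoc)
  qed (use bound in auto)
  moreover have "(\<lambda>n. absval w ^ n * C) \<longlonglongrightarrow> 0"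
    using w by (intro tendsto_mult_left_zero LIMSEQ_power_zero) simp
  ultimately have "absval (E f) \<le> 0"
    using f by (intro LIMSEQ_le_const) auto
  then show ?thesis
    using absval_nonneg[of "E f"] absval_eq_0_iff[of "E f"] by linarith
qed

section \<open>Evaluation at a fixed point of the open disk as a ring homomorphism\<close>

context
  fixes z :: 'a
  assumes z: "absval z < 1"
begin

lemma fps_value_sums:
  assumes "coeffs_le B f"
  shows "(\<lambda>n. fps_nth f n * z ^ n) sums fps_value f z"
proof -
  have "convergent (\<lambda>n. \<Sum>i<n. fps_nth f i * z ^ i)"
  proof (rule convergent_if_steps_tendsto_0)
    show "absval ((\<Sum>i<Suc n. fps_nth f i * z ^ i) - (\<Sum>i<n. fps_nth f i * z ^ i)) \<le> B * absval z ^ n"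
      for n using assms by (simp add: absval_mult absval_power coeffs_leD mult_right_mono)
    show "(\<lambda>n. B * absval z ^ n) \<longlonglongrightarrow> 0"
      using z by (intro tendsto_mult_right_zero LIMSEQ_power_zero) simp
  qed
  then show ?thesis
    by (simp add: fps_value_def summable_iff_convergent summable_sums)
qed

lemma absval_fps_value_le:
  assumes "coeffs_le B f"
  shows "absval (fps_value f z) \<le> B"
proof (rule LIMSEQ_absval_le)
  show "(\<lambda>n. \<Sum>i<n. fps_nth f i * z ^ i) \<longlonglongrightarrow> fps_value f z"
    using fps_value_sums[OF assms] by (simp add: sums_def)
  have "absval (fps_nth f i) * absval z ^ i \<le> B * 1" for i
    using assms z coeffs_le_nonneg[OF assms]
    by (intro mult_mono coeffs_leD power_le_one) auto
  then show "absval (\<Sum>i<n. fps_nth f i * z ^ i) \<le> B" for n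
    using coeffs_le_nonneg[OF assms]
    by (intro absval_sum_le) (auto simp: absval_mult absval_power)
qed

lemma fps_value_add:
  assumes "coeffs_le B f" "coeffs_le C g"
  shows "fps_value (f + g) z = fps_value f z + fps_value g z"
  using sums_add[OF assms[THEN fps_value_sums]]
  by (simp add: fps_value_def sums_iff ring_distribs)

lemma fps_value_const_mult:
  assumes "coeffs_le B f"
  shows "fps_value (fps_const c * f) z = c * fps_value f z"
proof -
  have "(\<lambda>n. c * (\<Sum>i<n. fps_nth f i * z ^ i)) \<longlonglongrightarrow> c * fps_value f z"
    using fps_value_sums[OF assms] by (intro tendsto_mult tendsto_const) (simp add: sums_def)
  then have "(\<lambda>n. fps_nth (fps_const c * f) n * z ^ n) sums (c * fps_value f z)"
    by (simp add: sums_def sum_distrib_left mult.assoc)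
  then show ?thesis by (simp add: fps_value_def sums_iff)
qed

lemma fps_value_diff:
  assumes "coeffs_le B f" "coeffs_le C g"
  shows "fps_value (f - g) z = fps_value f z - fps_value g z"
proof -
  have "fps_value (f + fps_const (-1) * g) z = fps_value f z + (-1) * fps_value g z"
    using assms coeffs_le_mult[OF coeffs_le_const[OF order_refl], of C g "-1"]
    by (subst fps_value_add[of B _ C]) (auto simp: fps_value_const_mult)
  then show ?thesis by (simp flip: fps_const_neg)
qed

lemma fps_value_const [simp]: "fps_value (fps_const c) z = c"
proof -
  have "(\<lambda>n. fps_nth (fps_const c) n * z ^ n) sums (\<Sum>n\<in>{0}. fps_nth (fps_const c) n * z ^ n)"
    by (rule sums_finite) auto
  then show ?thesis by (simp add: fps_value_def sums_iff)
qed

lemma fps_value_X_mult: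
  assumes "coeffs_le B f"
  shows "fps_value (fps_X * f) z = z * fps_value f z"
proof -
  have "(\<lambda>n. z * (\<Sum>i<n. fps_nth f i * z ^ i)) \<longlonglongrightarrow> z * fps_value f z"
    using fps_value_sums[OF assms] by (intro tendsto_mult tendsto_const) (simp add: sums_def)
  moreover have "(\<Sum>i<Suc n. fps_nth (fps_X * f) i * z ^ i) = z * (\<Sum>i<n. fps_nth f i * z ^ i)" for n
    by (subst sum.lessThan_Suc_shift) (simp add: fps_X_mult_nth sum_distrib_left mult_ac)
  ultimately have "(\<lambda>n. \<Sum>i<Suc n. fps_nth (fps_X * f) i * z ^ i) \<longlonglongrightarrow> z * fps_value f z"
    by simp
  then have "(\<lambda>n. fps_nth (fps_X * f) n * z ^ n) sums (z * fps_value f z)"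
    unfolding sums_def by (rule LIMSEQ_imp_Suc)
  then show ?thesis by (simp add: fps_value_def sums_iff)
qed

lemma fps_value_1 [simp]: "fps_value 1 z = 1"
  using fps_value_const[of 1] by simp

lemma fps_value_X [simp]: "fps_value fps_X z = z"
  using fps_value_X_mult[of 1 1] by (simp add: coeffs_le_def)

lemma fps_value_rec:
  assumes "coeffs_le B f"
  shows "fps_value f z = fps_nth f 0 + z * fps_value (fps_shift 1 f) z"
proof -
  have "coeffs_le B (fps_shift 1 f)"
    by (intro coeffs_le_shift assms)
  moreover from this have "coeffs_le (1 * B) (fps_X * fps_shift 1 f)"
    by (intro coeffs_le_mult coeffs_le_X)
  ultimately have "fps_value (fps_const (fps_nth f 0) + fps_X * fps_shift 1 f) z =
      fps_nth f 0 + z * fps_value (fps_shift 1 f) z"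
    by (subst fps_value_add[OF coeffs_le_const[OF order_refl]]) (auto simp: fps_value_X_mult)
  then show ?thesis by (simp only: fps_const_plus_X_mult_shift)
qed

text \<open>For fixed \<open>g\<close>, the failure of multiplicativity is a bounded defect in
  \<open>f\<close> as in \<open>shift_defect_eq_0\<close>: removing the constant term of
  \<open>f\<close> and one factor \<open>X\<close> pulls out a factor \<open>z\<close>.\<close>

lemma fps_value_mult:
  assumes f: "coeffs_le B f" and g: "coeffs_le C g"
  shows "fps_value (f * g) z = fps_value f z * fps_value g z"
proof -
  have "fps_value (f * g) z - fps_value f z * fps_value g z = 0"
  proof (rule shift_defect_eq_0[OF _ _ z f])
    fix f :: "'a fps" assume f: "coeffs_le B f"
    let ?f = "fps_shift 1 f"
    have fg: "f * g = fps_const (fps_nth f 0) * g + fps_X * (?f * g)"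
      by (subst fps_const_plus_X_mult_shift[symmetric]) (simp add: algebra_simps)
    have sg: "coeffs_le (B * C) (?f * g)"
      by (intro coeffs_le_mult coeffs_le_shift f g)
    have "fps_value (f * g) z = fps_nth f 0 * fps_value g z + z * fps_value (?f * g) z"
      unfolding fg
      by (subst fps_value_add[OF coeffs_le_mult[OF coeffs_le_const[OF order_refl] g]
            coeffs_le_mult[OF coeffs_le_X sg]])
         (simp add: fps_value_const_mult[OF g] fps_value_X_mult[OF sg] del: One_nat_def)
    then show "fps_value (f * g) z - fps_value f z * fps_value g z =
        z * (fps_value (?f * g) z - fps_value ?f z * fps_value g z)"
      by (simp add: fps_value_rec[OF f] algebra_simps)
    have "absval (fps_value f z) * absval (fps_value g z) \<le> B * C"
      using f g by (intro mult_mono absval_fps_value_le) (auto intro: coeffs_le_nonneg)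
    then show "absval (fps_value (f * g) z - fps_value f z * fps_value g z) \<le> B * C"
      by (intro absval_diff_le absval_fps_value_le coeffs_le_mult f g) (simp add: absval_mult)
  qed
  then show ?thesis by simp
qed

lemma fps_value_power:
  assumes "coeffs_le B f"
  shows "fps_value (f ^ n) z = fps_value f z ^ n"
  by (induction n) (auto simp: fps_value_mult[OF assms coeffs_le_power[OF assms]])

lemma fps_value_prod:
  assumes "\<And>i. i \<in> A \<Longrightarrow> coeffs_le 1 (f i)"
  shows "fps_value (\<Prod>i\<in>A. f i) z = (\<Prod>i\<in>A. fps_value (f i) z)"
  using assms
proof (induction A rule: infinite_finite_induct)
  case (insert i A)
  then show ?case
    by (simp add: fps_value_mult[of 1 "f i" 1] coeffs_le_prod_1)
qed auto

lemma fps_value_sum: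
  assumes "\<And>i. i \<in> A \<Longrightarrow> coeffs_le B (f i)" "0 \<le> B"
  shows "fps_value (\<Sum>i\<in>A. f i) z = (\<Sum>i\<in>A. fps_value (f i) z)"
  using assms
proof (induction A rule: infinite_finite_induct)
  case (insert i A)
  then show ?case
    by (simp add: fps_value_add[of B "f i" B] coeffs_le_sum)
qed (use fps_value_const[of 0] in auto)

lemma fps_value_X_minus_const [simp]: "fps_value (fps_X - fps_const w) z = z - w"
  using fps_value_diff[OF coeffs_le_X coeffs_le_const[OF order_refl], of w] by simp

lemma fps_value_split:
  assumes "coeffs_le B f"
  shows "fps_value f z = (\<Sum>i<n. fps_nth f i * z ^ i) + z ^ n * fps_value (fps_shift n f) z"
proof (induction n)
  case (Suc n)
  have "fps_value (fps_shift n f) z = fps_nth f n + z * fps_value (fps_shift (Suc n) f) z"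
    using fps_value_rec[OF coeffs_le_shift[OF assms], of n]
    by (simp add: fps_shift_fps_shift[symmetric, of 1, simplified] add.commute)
  with Suc.IH show ?case by (simp add: algebra_simps)
qed auto

lemma absval_fps_value_le_arg:
  assumes "coeffs_le B f" "fps_nth f 0 = 0"
  shows "absval (fps_value f z) \<le> absval z * B"
proof -
  have "fps_value f z = z * fps_value (fps_shift 1 f) z"
    using fps_value_rec[OF assms(1)] assms(2) by simp
  then show ?thesis
    by (simp add: absval_mult absval_fps_value_le[OF coeffs_le_shift[OF assms(1)]] mult_left_mono)
qed

end

text \<open>Again a defect argument, now with multiplier \<open>fps_value g z\<close>. This value
  lies in the open disk because \<open>g\<close> is integral without constant term, and
  \<open>f oo g\<close> is the constant term of \<open>f\<close> plus \<open>g\<close> times the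
  composite of the shifted series.\<close>

lemma fps_value_compose:
  fixes f g :: "'a fps"
  assumes z: "absval z < 1" and f: "coeffs_le B f" and g: "coeffs_le 1 g" "fps_nth g 0 = 0"
  shows "fps_value (f oo g) z = fps_value f (fps_value g z)"
proof -
  have gz: "absval (fps_value g z) < 1"
    using absval_fps_value_le_arg[OF z g] z by simp
  have "fps_value (f oo g) z - fps_value f (fps_value g z) = 0"
  proof (rule shift_defect_eq_0[OF _ _ gz f])
    fix f :: "'a fps" assume f: "coeffs_le B f"
    let ?f = "fps_shift 1 f"
    have fg: "f oo g = fps_const (fps_nth f 0) + g * (?f oo g)"
      by (subst fps_const_plus_X_mult_shift[symmetric, of f])
         (simp only: fps_compose_add_distrib fps_compose_mult_distrib[OF g(2)]
            fps_X_fps_compose_startby0[OF g(2)] fps_const_compose)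
    have s: "coeffs_le B (?f oo g)"
      by (intro coeffs_le_compose coeffs_le_shift f g)
    have "fps_value (f oo g) z = fps_nth f 0 + fps_value g z * fps_value (?f oo g) z"
      unfolding fg
      by (subst fps_value_add[OF z coeffs_le_const[OF order_refl] coeffs_le_mult[OF g(1) s]])
         (simp add: fps_value_mult[OF z g(1) s] z del: One_nat_def)
    then show "fps_value (f oo g) z - fps_value f (fps_value g z) =
        fps_value g z * (fps_value (?f oo g) z - fps_value ?f (fps_value g z))"
      by (simp add: fps_value_rec[OF gz f] algebra_simps)
    show "absval (fps_value (f oo g) z - fps_value f (fps_value g z)) \<le> B"
      by (intro absval_diff_le absval_fps_value_le z gz f coeffs_le_compose g)
  qed
  then show ?thesis by simp
qed

text \<open>Division by \<open>X - w\<close> as in Horner's scheme: each coefficient of the quotient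
  is the value at \<open>w\<close> of a tail of \<open>f\<close>. Evaluation does not exceed the
  coefficient bound, so the quotient inherits \<open>B\<close>.\<close>

lemma fps_value_zero_factor:
  fixes f :: "'a fps"
  assumes f: "coeffs_le B f" and w: "absval w < 1" and "fps_value f w = 0"
  obtains g where "coeffs_le B g" "f = (fps_X - fps_const w) * g"
proof
  define g where "g = Abs_fps (\<lambda>m. fps_value (fps_shift (Suc m) f) w)"
  show "coeffs_le B g"
    by (auto simp: coeffs_le_def g_def intro!: absval_fps_value_le w coeffs_le_shift f)
  show "f = (fps_X - fps_const w) * g"
  proof (rule fps_ext)
    fix n
    have rec: "fps_value (fps_shift m f) w = fps_nth f m + w * fps_value (fps_shift (Suc m) f) w" for m
      using fps_value_split[OF w coeffs_le_shift[OF f], of m 1]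
      by (simp add: fps_shift_fps_shift[symmetric, of 1, simplified] add.commute)
    show "fps_nth f n = fps_nth ((fps_X - fps_const w) * g) n"
      using rec[of n] assms(3)
      by (cases n) (auto simp: left_diff_distrib g_def fps_X_mult_nth eq_neg_iff_add_eq_0 algebra_simps)
  qed
qed

text \<open>The zeros are split off one at a time: at a zero different from \<open>w\<close> the
  factor \<open>X - w\<close> does not vanish, so the quotient does, and the bound \<open>B\<close>
  survives every division.\<close>

lemma fps_value_zeros_factor:
  fixes f :: "'a fps"
  assumes "finite W" "coeffs_le B f" "\<And>w. w \<in> W \<Longrightarrow> absval w < 1 \<and> fps_value f w = 0"
  shows "\<exists>g. coeffs_le B g \<and> f = (\<Prod>w\<in>W. fps_X - fps_const w) * g"
  using assms
proof (induction W arbitrary: f rule: finite_induct)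
  case (insert w W)
  then obtain g where g: "coeffs_le B g" "f = (fps_X - fps_const w) * g"
    using fps_value_zero_factor[of B f w] by blast
  have "fps_value g x = 0" if "x \<in> W" for x
  proof -
    have "absval x < 1" "fps_value f x = 0" "x \<noteq> w" "absval w < 1"
      using insert that by auto
    then show ?thesis
      using fps_value_mult[OF _ coeffs_le_X_minus_const g(1), of x w] g(2) by auto
  qed
  with insert.IH[OF g(1)] insert.prems obtain h
    where "coeffs_le B h" "g = (\<Prod>w\<in>W. fps_X - fps_const w) * h" by blast
  with g insert.hyps show ?case by (auto simp: mult.assoc)
qed auto

text \<open>The series \<open>f - fps_value f y\<close> vanishes at \<open>y\<close>, hence is
  \<open>X - y\<close> times a series that is still bounded by \<open>B\<close>.\<close>

lemma fps_value_lipschitz: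
  fixes f :: "'a fps"
  assumes f: "coeffs_le B f" and x: "absval x < 1" and y: "absval y < 1"
  shows "absval (fps_value f x - fps_value f y) \<le> absval (x - y) * B"
proof -
  have "absval (fps_value f y) \<le> B" by (intro absval_fps_value_le y f)
  then have h: "coeffs_le B (f - fps_const (fps_value f y))"
    by (intro coeffs_le_diff f coeffs_le_const)
  have v: "fps_value (f - fps_const (fps_value f y)) u = fps_value f u - fps_value f y"
    if "absval u < 1" for u
    using that by (subst fps_value_diff[OF _ f coeffs_le_const[OF order_refl]]) auto
  from v[OF y] obtain g where g: "coeffs_le B g"
      "f - fps_const (fps_value f y) = (fps_X - fps_const y) * g"
    using fps_value_zero_factor[OF h y] by auto
  then have "fps_value f x - fps_value f y = (x - y) * fps_value g x"
    using v[OF x] fps_value_mult[OF x coeffs_le_X_minus_const g(1), of y] x y by simp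
  then show ?thesis
    by (simp add: absval_mult absval_fps_value_le[OF x g(1)] mult_left_mono)
qed

end

section \<open>Algebraic closedness\<close>

lemma poly_tendsto:
  fixes x :: "'a::nonarch_field"
  assumes "(s \<longlongrightarrow> x) F"
  shows "((\<lambda>n. poly g (s n)) \<longlongrightarrow> poly g x) F"
  by (induction g) (auto intro!: tendsto_intros assms)

lemma absval_poly_le:
  fixes g :: "'a::nonarch_field poly"
  assumes "degree g \<le> d" "\<And>i. absval (coeff g i) \<le> e" "absval x \<le> C" "1 \<le> C"
  shows "absval (poly g x) \<le> e * C ^ d"
proof -
  have e: "0 \<le> e" using assms(2) absval_nonneg order_trans by blast
  have "absval (coeff g i) * absval x ^ i \<le> e * C ^ d" if "i \<le> degree g" for i
  proof (intro mult_mono assms)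
    have "absval x ^ i \<le> C ^ i" using assms by (intro power_mono) auto
    also have "\<dots> \<le> C ^ d" using assms that by (intro power_increasing) auto
    finally show "absval x ^ i \<le> C ^ d" .
  qed (use e in auto)
  then show ?thesis
    unfolding poly_altdef using e assms
    by (intro absval_sum_le) (auto simp: absval_mult absval_power)
qed

text \<open>If \<open>absval x > B \<ge> 1\<close>, the leading term strictly dominates all other
  terms, so the value at \<open>x\<close> cannot vanish.\<close>

lemma absval_root_le:
  fixes g :: "'a::nonarch_field poly"
  assumes "lead_coeff g = 1" "\<And>i. absval (coeff g i) \<le> B" "1 \<le> B" "poly g x = 0"
  shows "absval x \<le> B"
proof (rule ccontr)
  assume x: "\<not> absval x \<le> B"
  define d where "d = degree g"
  have "absval (coeff g i * x ^ i) < absval x ^ d" if "i < d" for i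
  proof -
    have "absval (coeff g i * x ^ i) \<le> B * absval x ^ i"
      using assms by (simp add: absval_mult absval_power mult_right_mono)
    also have "\<dots> < absval x * absval x ^ i"
      using x assms by (intro mult_strict_right_mono zero_less_power) auto
    also have "\<dots> \<le> absval x ^ d"
      using that x assms power_increasing[of "Suc i" d "absval x"] by simp
    finally show ?thesis .
  qed
  then have "absval (\<Sum>i\<in>A. coeff g i * x ^ i) < absval x ^ d" if "A \<subseteq> {..<d}" for A
    using that finite_subset[OF that]
  proof (induction A rule: infinite_finite_induct)
    case empty
    have "0 < absval x" using x assms(3) by linarith
    then show ?case by simp
  next
    case (insert i A)
    then show ?case by (simp add: absval_add_less)
  qed auto
  then have "absval (\<Sum>i<d. coeff g i * x ^ i) < absval (x ^ d)"
    by (simp add: absval_power)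
  then have "absval (x ^ d + (\<Sum>i<d. coeff g i * x ^ i)) = absval (x ^ d)"
    by (rule absval_add_eq)
  moreover have "poly g x = x ^ d + (\<Sum>i<d. coeff g i * x ^ i)"
    unfolding poly_altdef using assms(1) by (simp add: d_def flip: lessThan_Suc_atMost)
  ultimately show False using assms x by (simp add: absval_power)
qed

text \<open>The hypothesis on smaller degrees provides the factorization of \<open>g\<close> into linear factors.\<close>

lemma power_degree_le_absval_poly:
  fixes g :: "'a::nonarch_field poly"
  assumes IH: "\<And>h :: 'a poly. lead_coeff h = 1 \<Longrightarrow> 0 < degree h \<Longrightarrow> degree h < d \<Longrightarrow> \<exists>x. poly h x = 0"
    and "lead_coeff g = 1" "degree g \<le> d" "degree g = d \<Longrightarrow> \<exists>x. poly g x = 0"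
    and "0 \<le> r" "\<And>x. poly g x = 0 \<Longrightarrow> r \<le> absval (z - x)"
  shows "r ^ degree g \<le> absval (poly g z)"
  using assms(2-)
proof (induction "degree g" arbitrary: g)
  case 0
  then obtain a where "g = [:a:]" using degree_eq_zeroE by metis
  with 0 show ?case by simp
next
  case (Suc n)
  obtain x where x: "poly g x = 0"
    using Suc IH[of g] by (cases "degree g = d") auto
  then obtain h where h: "g = [:-x, 1:] * h"
    using poly_eq_0_iff_dvd by blast
  then have "h \<noteq> 0" using Suc by auto
  then have n: "degree h = n" using Suc.hyps(2) unfolding h by (subst (asm) degree_mult_eq) auto
  have "r ^ degree h \<le> absval (poly h z)"
  proof (rule Suc.hyps(1))
    show "lead_coeff h = 1" using Suc.prems(1) unfolding h lead_coeff_mult by simp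
  qed (use Suc n in \<open>auto simp: h\<close>)
  then have "r * r ^ n \<le> absval (z - x) * absval (poly h z)"
    using Suc.prems x n by (intro mult_mono) auto
  also have "\<dots> = absval (poly g z)"
    by (simp add: h absval_mult[symmetric] algebra_simps)
  finally show ?case using Suc.hyps(2)[symmetric] by simp
qed

locale Cp_field =
  fixes p :: nat and ty :: "'a::nonarch_field itself"
  assumes prime_p: "prime p" and is_Cp: "is_Cp p TYPE('a)"
begin

sublocale complete_nonarch ty
  by unfold_locales (use is_Cp in \<open>simp add: is_Cp_def\<close>)

lemma absval_p: "absval (of_nat p :: 'a) = 1 / real p"
  using is_Cp by (simp add: is_Cp_def)

lemma p_gt_1: "1 < p"
  using prime_p prime_gt_1_nat by blast

text \<open>These are the roots of \<open>X\<close> and \<open>X - 1\<close>. They occur as the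
  vanishing and the leading coefficients of the approximating polynomials below.\<close>

lemma zero_one_in_Qp_bar: "(0::'a) \<in> Qp_bar" "(1::'a) \<in> Qp_bar"
proof -
  have Q: "\<rat> \<subseteq> (Qp :: 'a set)" by (simp add: Qp_def closure_subset)
  have "coeff [:0, 1:] i \<in> (Qp :: 'a set)" "coeff [:-1, 1:] i \<in> (Qp :: 'a set)" for i
    using Q by (auto simp: coeff_pCons split: nat.splits intro!: set_mp[OF Q])
  then have "[:0, 1:] \<noteq> (0 :: 'a poly) \<and> (\<forall>i. coeff [:0, 1::'a:] i \<in> Qp) \<and> poly [:0, 1:] (0::'a) = 0"
    and "[:-1, 1:] \<noteq> (0 :: 'a poly) \<and> (\<forall>i. coeff [:-1, 1::'a:] i \<in> Qp) \<and> poly [:-1, 1:] (1::'a) = 0"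
    by auto
  then have "\<exists>f :: 'a poly. f \<noteq> 0 \<and> (\<forall>i. coeff f i \<in> Qp) \<and> poly f 0 = 0"
    and "\<exists>f :: 'a poly. f \<noteq> 0 \<and> (\<forall>i. coeff f i \<in> Qp) \<and> poly f 1 = 0"
    by blast+
  then show "(0::'a) \<in> Qp_bar" "(1::'a) \<in> Qp_bar"
    by (simp_all add: Qp_bar_def algebraic_elements_over_def)
qed

text \<open>Density moves the lower coefficients into \<open>Qp_bar\<close> while the leading
  coefficient stays \<open>1\<close>; the root exists because \<open>Qp_bar\<close> is algebraically
  closed.\<close>

lemma monic_poly_approx:
  fixes g :: "'a poly"
  assumes "lead_coeff g = 1" "0 < degree g" "0 < e"
  obtains g' where "lead_coeff g' = 1" "degree g' = degree g"
    "\<And>i. absval (coeff (g' - g) i) \<le> e" "\<exists>x. poly g' x = 0"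
proof -
  have "\<exists>b\<in>Qp_bar. dist b (coeff g i) < e" for i
    using is_Cp assms(3) closure_approachable[of "coeff g i" Qp_bar] by (auto simp: is_Cp_def)
  then obtain b where b: "\<And>i. b i \<in> Qp_bar" "\<And>i. dist (b i) (coeff g i) < e" by metis
  define d where "d = degree g"
  define g' where "g' = (\<Sum>i<d. monom (b i) i) + monom 1 d"
  have c: "coeff g' i = (if i < d then b i else if i = d then 1 else 0)" for i
    by (auto simp: g'_def coeff_sum)
  then have deg: "degree g' = d"
    by (intro antisym degree_le le_degree) auto
  show ?thesis
  proof
    show "absval (coeff (g' - g) i) \<le> e" for i
      using b(2)[of i] assms coeff_eq_0[of g i] by (auto simp: c dist_absval d_def)
    have "coeff g' i \<in> Qp_bar" for i
      using b(1) zero_one_in_Qp_bar by (simp add: c)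
    moreover have "algebraically_closed_subset (Qp_bar :: 'a set)"
      using is_Cp by (simp add: is_Cp_def)
    ultimately show "\<exists>x. poly g' x = 0"
      using assms(2) deg unfolding algebraically_closed_subset_def d_def by metis
  qed (use deg c d_def in auto)
qed

text \<open>Continuity of roots: \<open>g\<close> is the limit of monic polynomials that have roots,
  consecutive roots can be chosen close together, and completeness gives a limit, which is a root of
  \<open>g\<close>. The induction on the degree supplies the splitting required by
  \<open>power_degree_le_absval_poly\<close>.\<close>

lemma monic_poly_root:
  fixes g :: "'a poly"
  assumes "lead_coeff g = 1" "0 < degree g"
  shows "\<exists>x. poly g x = 0"
  using assms
proof (induction "degree g" arbitrary: g rule: less_induct)
  case (less g)
  define d where "d = degree g"
  define B where "B = Max (insert 1 ((\<lambda>i. absval (coeff g i)) ` {..d}))"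
  have B: "1 \<le> B" "absval (coeff g i) \<le> B" for i
  proof -
    show B1: "1 \<le> B" unfolding B_def by (rule Max_ge) auto
    show "absval (coeff g i) \<le> B"
    proof (cases "i \<le> d")
      case True
      then show ?thesis unfolding B_def by (intro Max_ge) auto
    next
      case False
      then have "coeff g i = 0" by (intro coeff_eq_0) (simp add: d_def)
      with B1 show ?thesis by simp
    qed
  qed
  \<comment> \<open>Roots of the approximants have absolute value at most \<open>B\<close>, so a
    polynomial of degree at most \<open>d\<close> with coefficients bounded by \<open>e k\<close> is
    at most \<open>e k * B ^ d\<close> there. The factor 2 makes this strictly less than
    \<open>((1/2) ^ k) ^ d\<close>.\<close>
  define e where "e k = (1/2) ^ (k * d) / (2 * B ^ d)" for k
  have e: "0 < e k" "e k \<le> 1" "e (Suc k) \<le> e k" "e k * B ^ d < ((1/2) ^ k) ^ d" for k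
  proof -
    have Bd: "1 \<le> B ^ d" using B by simp
    show "0 < e k" using B by (simp add: e_def)
    have "(1/2::real) ^ (k * d) \<le> 1" by (intro power_le_one) auto
    then show "e k \<le> 1" using Bd by (simp add: e_def divide_le_eq)
    have "(1/2::real) ^ (Suc k * d) \<le> (1/2) ^ (k * d)" by (intro power_decreasing) auto
    then show "e (Suc k) \<le> e k" unfolding e_def using B by (intro divide_right_mono) auto
    show "e k * B ^ d < ((1/2) ^ k) ^ d" using B by (simp add: e_def flip: power_mult)
  qed
  have "\<forall>k. \<exists>g'. lead_coeff g' = 1 \<and> degree g' = d \<and> (\<forall>i. absval (coeff (g' - g) i) \<le> e k) \<and>
      (\<exists>x. poly g' x = 0)"
    using monic_poly_approx[OF less.prems e(1)] d_def by metis
  then obtain G where G: "\<And>k. lead_coeff (G k) = 1" "\<And>k. degree (G k) = d"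
      "\<And>k i. absval (coeff (G k - g) i) \<le> e k" "\<And>k. \<exists>x. poly (G k) x = 0"
    by metis
  have GB: "absval (coeff (G k) i) \<le> B" for k i
    using absval_add_le[of "coeff (G k - g) i" B "coeff g i"] G(3)[of k i] e(2)[of k] B by simp
  have close: "absval (poly h x) < ((1/2) ^ k) ^ d"
    if "poly (G k) x = 0" "degree h \<le> d" "\<And>i. absval (coeff h i) \<le> e k" for k h x
  proof -
    have "absval x \<le> B" using absval_root_le[OF G(1) GB B(1) that(1)] .
    then have "absval (poly h x) \<le> e k * B ^ d"
      using that B by (intro absval_poly_le) auto
    with e(4)[of k] show ?thesis by simp
  qed
  \<comment> \<open>At a root of \<open>G k\<close>, the value of \<open>G (Suc k)\<close> is the
    product of the distances to its \<open>d\<close> roots. As it is below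
    \<open>((1/2) ^ k) ^ d\<close>, some root is closer than \<open>(1/2) ^ k\<close>.\<close>
  have "\<exists>x. \<forall>k. poly (G k) (x k) = 0 \<and> absval (x (Suc k) - x k) < (1/2) ^ k"
  proof (rule dependent_nat_choice)
    show "\<exists>x. poly (G 0) x = 0" by (rule G)
    fix x k assume x: "poly (G k) x = 0"
    have "absval (poly (G (Suc k) - G k) x) < ((1/2) ^ k) ^ d"
    proof (rule close[OF x])
      show "degree (G (Suc k) - G k) \<le> d" using G(2) by (metis degree_diff_le order_refl)
      have "coeff (G (Suc k) - G k) i = coeff (G (Suc k) - g) i - coeff (G k - g) i" for i
        by simp
      then show "absval (coeff (G (Suc k) - G k) i) \<le> e k" for i
        using G(3)[of "Suc k" i] G(3)[of k i] e(3)[of k]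
        by (metis absval_diff_le order_trans)
    qed
    then have "absval (poly (G (Suc k)) x) < ((1/2) ^ k) ^ degree (G (Suc k))"
      using x G by simp
    moreover have "((1/2) ^ k) ^ degree (G (Suc k)) \<le> absval (poly (G (Suc k)) x)"
      if "\<And>y. poly (G (Suc k)) y = 0 \<Longrightarrow> (1/2) ^ k \<le> absval (x - y)"
      using that G less.hyps by (intro power_degree_le_absval_poly[of d]) (auto simp: d_def)
    ultimately show "\<exists>y. poly (G (Suc k)) y = 0 \<and> absval (y - x) < (1/2) ^ k"
      by (metis absval_minus_commute not_le)
  qed
  then obtain x where x: "\<And>k. poly (G k) (x k) = 0" "\<And>k. absval (x (Suc k) - x k) < (1/2) ^ k"
    by blast
  have lim0: "(\<lambda>k. (1/2::real) ^ k) \<longlonglongrightarrow> 0" by (intro LIMSEQ_power_zero) simp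
  then have "convergent x"
    using x(2) by (intro convergent_if_steps_tendsto_0[OF less_imp_le])
  then obtain l where "x \<longlonglongrightarrow> l" by (auto simp: convergent_def)
  then have "(\<lambda>k. poly g (x k)) \<longlonglongrightarrow> poly g l" by (rule poly_tendsto)
  moreover have "(\<lambda>k. poly g (x k)) \<longlonglongrightarrow> 0"
    unfolding tendsto_absval_iff
  proof (rule tendsto_sandwich[OF _ _ tendsto_const lim0])
    have "absval (poly g (x k)) \<le> (1/2) ^ k" for k
    proof -
      have "absval (poly (G k - g) (x k)) < ((1/2) ^ k) ^ d"
        using G(2)[of k] by (intro close x G) (metis d_def degree_diff_le order_refl)
      moreover have "((1/2::real) ^ k) ^ d \<le> ((1/2) ^ k) ^ 1"
        using less.prems(2) by (intro power_decreasing) (auto simp: d_def power_le_one)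
      ultimately show ?thesis using x(1)[of k] by simp
    qed
    then show "\<forall>\<^sub>F k in sequentially. absval (poly g (x k) - 0) \<le> (1/2) ^ k" by simp
  qed auto
  ultimately show ?case using LIMSEQ_unique by blast
qed

lemma poly_root:
  fixes g :: "'a poly"
  assumes "0 < degree g"
  shows "\<exists>x. poly g x = 0"
proof -
  have "lead_coeff g \<noteq> 0" using assms by auto
  then show ?thesis
    using monic_poly_root[of "smult (inverse (lead_coeff g)) g"] assms by auto
qed

text \<open>A Newton polygon statement, used in contrapositive form to find roots in the open disk.
  Multiplication by \<open>X - x\<close> with \<open>absval x \<ge> 1\<close> preserves the
  dominance of the constant coefficient, and \<open>g\<close> splits into such factors.\<close>

lemma absval_coeff_le_coeff_0:
  fixes g :: "'a poly"
  assumes "\<And>x. poly g x = 0 \<Longrightarrow> 1 \<le> absval x"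
  shows "absval (coeff g i) \<le> absval (coeff g 0)"
  using assms
proof (induction "degree g" arbitrary: g i)
  case 0
  then show ?case by (cases i) (auto simp: coeff_eq_0)
next
  case (Suc n)
  obtain x where x: "poly g x = 0" using poly_root[of g] Suc by auto
  then obtain h where h: "g = [:-x, 1:] * h"
    using poly_eq_0_iff_dvd by blast
  then have "h \<noteq> 0" using Suc by auto
  then have "n = degree h" using Suc.hyps(2) unfolding h by (subst (asm) degree_mult_eq) auto
  then have IH: "absval (coeff h i) \<le> absval (coeff h 0)" for i
    by (rule Suc.hyps(1)) (use Suc.prems h in auto)
  have "1 \<le> absval x" using Suc.prems x by blast
  then have "absval (coeff h i) \<le> absval x * absval (coeff h 0)"
     "absval x * absval (coeff h i) \<le> absval x * absval (coeff h 0)" for i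
    using IH[of i] mult_mono[of 1 "absval x" "absval (coeff h i)" "absval (coeff h 0)"] 
    by (auto intro: mult_left_mono)
  then show ?case
    by (cases i) (auto simp: h absval_mult intro!: absval_diff_le)
qed

text \<open>After rescaling by \<open>t\<close>, a long truncation of \<open>f\<close> is a
  polynomial whose \<open>j\<close>-th coefficient exceeds the constant one, so it has a root in the
  open disk. At this root only the tail of \<open>f\<close> remains, and it is below
  \<open>e\<close>.\<close>

lemma approx_zero_in_disk:
  fixes f :: "'a fps" and t :: 'a
  assumes f: "coeffs_le B f" and t: "absval t < 1"
    and j: "absval (fps_nth f 0) < absval (fps_nth f j) * absval t ^ j" and e: "0 < e"
  shows "\<exists>x. absval x < absval t \<and> absval (fps_value f x) \<le> e"
proof -
  have "(\<lambda>n. absval t ^ n * B) \<longlonglongrightarrow> 0"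
    using t by (intro tendsto_mult_left_zero LIMSEQ_power_zero) simp
  then have "\<forall>\<^sub>F n in sequentially. absval t ^ n * B < e \<and> j < n"
    using e by (intro eventually_conj order_tendstoD(2)) (auto simp: eventually_gt_at_top)
  then obtain N where N: "absval t ^ N * B < e" "j < N"
    unfolding eventually_sequentially by blast
  \<comment> \<open>The truncation of \<open>f\<close> evaluated at \<open>t * X\<close>;
    \<open>j < N\<close> keeps the dominating coefficient.\<close>
  define g where "g = (\<Sum>i<N. monom (fps_nth f i * t ^ i) i)"
  have c: "coeff g i = (if i < N then fps_nth f i * t ^ i else 0)" for i
    unfolding g_def coeff_sum coeff_monom by (subst sum.delta) auto
  have "absval (coeff g 0) < absval (coeff g j)"
    using N j by (simp add: c absval_mult absval_power)
  then obtain y where y: "poly g y = 0" "absval y < 1"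
    using absval_coeff_le_coeff_0[of g j] by force
  define x where "x = t * y"
  have "t \<noteq> 0" using j by (auto simp: power_0_left split: if_splits)
  then have xt: "absval x < absval t" using y by (simp add: x_def absval_mult)
  have "(\<Sum>i<N. fps_nth f i * x ^ i) = poly g y"
    by (simp add: g_def poly_sum poly_monom x_def power_mult_distrib mult.assoc)
  then have "fps_value f x = x ^ N * fps_value (fps_shift N f) x"
    using fps_value_split[OF _ f, of x N] xt t y by simp
  then have "absval (fps_value f x) \<le> absval x ^ N * B"
    using absval_fps_value_le[OF _ coeffs_le_shift[OF f], of x N] xt t
    by (simp add: absval_mult absval_power mult_left_mono)
  also have "\<dots> \<le> absval t ^ N * B"
    using xt coeffs_le_nonneg[OF f] by (intro mult_right_mono power_mono) auto
  finally show ?thesis using xt N by (intro exI[of _ x]) auto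
qed

text \<open>A root \<open>t\<close> of \<open>X ^ (n * m) - p\<close> has
  \<open>(absval t ^ n) ^ m = 1 / p\<close>, which exceeds \<open>r ^ m\<close> for nonnegative
  \<open>r < 1\<close> and large \<open>m\<close>. A negative \<open>r\<close> is first replaced by
  \<open>0\<close>.\<close>

lemma exists_absval_power_gt:
  assumes "r < 1" "0 < n"
  shows "\<exists>t::'a. t \<noteq> 0 \<and> absval t < 1 \<and> r < absval t ^ n"
proof -
  define r' where "r' = max r 0"
  have r': "0 \<le> r'" "r' < 1" "r \<le> r'" using assms by (auto simp: r'_def)
  have p: "0 < 1 / real p" "1 / real p < 1" using p_gt_1 by auto
  obtain m where m: "r' ^ m < 1 / real p"
    using real_arch_pow_inv[OF p(1) r'(2)] by blast
  have m0: "0 < m" using m p by (cases m) auto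
  have "degree (monom 1 (n * m) + [:- of_nat p:] :: 'a poly) = n * m"
    using m0 assms by (subst degree_add_eq_left) (auto simp: degree_monom_eq)
  then obtain t :: 'a where "poly (monom 1 (n * m) + [:- of_nat p:]) t = 0"
    using poly_root[of "monom 1 (n * m) + [:- of_nat p:]"] m0 assms by auto
  then have "t ^ (n * m) = of_nat p" by (simp add: poly_monom)
  then have t: "(absval t ^ n) ^ m = 1 / real p"
    by (metis absval_p absval_power power_mult)
  have "r' < absval t ^ n"
    using m unfolding t[symmetric] by (rule power_less_imp_less_base) simp
  moreover have "absval t ^ n < 1"
    using power_less_imp_less_base[of "absval t ^ n" m 1] t p by simp
  then have "absval t < 1"
    using power_less_imp_less_base[of "absval t" n 1] by simp
  moreover have "t \<noteq> 0" using t p assms m0 by (intro notI) (simp add: power_0_left)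
  ultimately show ?thesis using r' by force
qed

text \<open>The Gauss norm is attained by the values on the disk. If the \<open>i\<close>-th
  coefficient exceeds \<open>S\<close>, there is a constant \<open>b\<close> with
  \<open>absval b > S\<close> such that \<open>f - b\<close> has an approximate zero; near it
  \<open>f\<close> takes a value of absolute value \<open>absval b\<close>.\<close>

lemma coeffs_le_if_values_le:
  fixes f :: "'a fps"
  assumes f: "coeffs_le B f" and S: "\<And>z. absval z < 1 \<Longrightarrow> absval (fps_value f z) \<le> S"
  shows "coeffs_le S f"
  unfolding coeffs_le_def
proof (rule allI, rule ccontr)
  fix i assume "\<not> absval (fps_nth f i) \<le> S"
  then have i: "S < absval (fps_nth f i)" by simp
  have f0: "absval (fps_nth f 0) \<le> S"
    using S[of 0] fps_value_rec[OF _ f, of 0] by simp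
  then have S0: "0 \<le> S" using absval_nonneg order_trans by blast
  have "0 < i" using f0 i by (cases i) auto
  have "S / absval (fps_nth f i) < 1"
    using i S0 by (subst divide_less_eq_1_pos) auto
  then obtain t :: 'a where t: "t \<noteq> 0" "absval t < 1" "S / absval (fps_nth f i) < absval t ^ (2 * i)"
    using exists_absval_power_gt[of _ "2 * i"] \<open>0 < i\<close> by auto
  \<comment> \<open>The exponent is \<open>2 * i\<close> because one factor \<open>t ^ i\<close> is
    kept in reserve: \<open>absval b\<close> still exceeds \<open>S\<close>, yet is strictly below
    \<open>absval (fps_nth f i) * absval t ^ i\<close>.\<close>
  define b where "b = fps_nth f i * t ^ (2 * i)"
  have b: "S < absval b"
    using t(3) i S0 by (subst (asm) pos_divide_less_eq) (auto simp: b_def absval_mult absval_power mult_ac)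
  have "absval b < absval (fps_nth f i) * absval t ^ i"
    using t i S0 \<open>0 < i\<close>
    by (auto simp: b_def absval_mult absval_power intro!: mult_strict_left_mono power_strict_decreasing)
  moreover have F: "coeffs_le (max B (absval b)) (f - fps_const b)"
    by (intro coeffs_le_diff coeffs_le_const) (auto intro: coeffs_le_mono[OF f])
  moreover have "absval (fps_nth (f - fps_const b) 0) \<le> absval b"
    using f0 b by (auto intro: absval_diff_le)
  ultimately have "\<exists>x. absval x < absval t \<and> absval (fps_value (f - fps_const b) x) \<le> absval b / 2"
    using t b S0 \<open>0 < i\<close> by (intro approx_zero_in_disk[OF F t(2), of i]) auto
  then obtain x where x: "absval x < 1" "absval (fps_value (f - fps_const b) x) \<le> absval b / 2"
    using t by (meson order.strict_trans)
  have "absval (b - fps_value f x) \<le> absval b / 2"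
    using x fps_value_diff[OF x(1) f coeffs_le_const[OF order_refl], of b]
    by (simp add: absval_minus_commute)
  then have "absval (b - fps_value f x + fps_value f x) \<le> max (absval b / 2) S"
    using S[OF x(1)] by (intro absval_add_le) auto
  then show False using b S0 by auto
qed

end

section \<open>The dynamics of an LT-like series\<close>

context Cp_field
begin

text \<open>In the binomial expansion of \<open>(u + y) ^ p\<close> with \<open>u = x - y\<close>,
  the inner coefficients are divisible by \<open>p\<close> and come with a factor \<open>y\<close>,
  while the last term \<open>u ^ p\<close> is at most \<open>absval u ^ 2\<close>.\<close>

lemma absval_power_prime_diff_le:
  fixes x y :: 'a
  assumes "absval x \<le> \<rho>" "absval y \<le> \<rho>" "\<rho> < 1"
  shows "absval (x ^ p - y ^ p) \<le> absval (x - y) * max (\<rho> / real p) (absval (x - y))"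
proof -
  define u where "u = x - y"
  have u: "absval u \<le> \<rho>" using assms by (auto simp: u_def intro: absval_diff_le)
  have \<rho>: "0 \<le> \<rho>" using assms(1) absval_nonneg order_trans by blast
  have "x ^ p = (\<Sum>k\<le>p. of_nat (p choose k) * u ^ k * y ^ (p - k))"
    using binomial_ring[of u y p] by (simp add: u_def)
  also have "{..p} = insert 0 {1..p}" by auto
  finally have "x ^ p - y ^ p = (\<Sum>k\<in>{1..p}. of_nat (p choose k) * u ^ k * y ^ (p - k))"
    by simp
  also have "absval \<dots> \<le> absval u * max (\<rho> / real p) (absval u)"
  proof (intro absval_sum_le mult_nonneg_nonneg)
    fix k assume k: "k \<in> {1..p}"
    show "absval (of_nat (p choose k) * u ^ k * y ^ (p - k)) \<le> absval u * max (\<rho> / real p) (absval u)"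
    proof (cases "k = p")
      case True
      have "absval u ^ p \<le> absval u ^ 2" using u assms p_gt_1 by (intro power_decreasing) auto
      also have "\<dots> \<le> absval u * max (\<rho> / real p) (absval u)"
        by (auto simp: power2_eq_square intro: mult_left_mono)
      finally show ?thesis using True by (simp add: absval_power)
    next
      case False
      then obtain m where m: "p choose k = p * m"
        using dvd_choose_prime[of k p] k prime_p p_gt_1 by auto
      have "absval (of_nat p :: 'a) * absval (of_nat m :: 'a) \<le> 1 / real p * 1"
        using p_gt_1 by (intro mult_mono) (auto simp: absval_p absval_of_nat_le)
      then have "absval (of_nat (p choose k) :: 'a) \<le> 1 / real p"
        by (simp add: m absval_mult)
      moreover have "absval u ^ k \<le> absval u ^ 1"
        using u assms k by (intro power_decreasing) auto
      moreover have "absval y ^ (p - k) \<le> absval y ^ 1"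
        using assms k False by (intro power_decreasing) auto
      ultimately have "absval (of_nat (p choose k) :: 'a) * absval u ^ k * absval y ^ (p - k)
          \<le> 1 / real p * absval u * \<rho>"
        using assms by (intro mult_mono) auto
      also have "\<dots> = absval u * (\<rho> / real p)" by simp
      also have "\<dots> \<le> absval u * max (\<rho> / real p) (absval u)"
        by (intro mult_left_mono) auto
      finally show ?thesis by (simp add: absval_mult absval_power)
    qed
  qed (use \<rho> in \<open>auto simp: le_max_iff_disj\<close>)
  finally show ?thesis by (simp add: u_def)
qed

text \<open>Taking \<open>p ^ h\<close>-th powers preserves the ball of radius \<open>\<rho>\<close>
  and does not increase distances, so a further \<open>p\<close>-th power keeps the
  estimate.\<close>

lemma absval_power_prime_power_diff_le:
  fixes x y :: 'a
  assumes "absval x \<le> \<rho>" "absval y \<le> \<rho>" "\<rho> < 1" "0 < h"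
  shows "absval (x ^ (p ^ h) - y ^ (p ^ h)) \<le> absval (x - y) * max (\<rho> / real p) (absval (x - y))"
  using assms(4)
proof (induction h rule: nat_induct_non_zero)
  case 1
  then show ?case using absval_power_prime_diff_le[OF assms(1-3)] by simp
next
  case (Suc h)
  define v where "v = x ^ (p ^ h) - y ^ (p ^ h)"
  define M where "M = max (\<rho> / real p) (absval (x - y))"
  have \<rho>: "0 \<le> \<rho>" using assms(1) absval_nonneg order_trans by blast
  have le: "absval (w ^ (p ^ h)) \<le> \<rho>" if "absval w \<le> \<rho>" for w :: 'a
  proof -
    have "absval w ^ (p ^ h) \<le> absval w ^ 1"
      using that assms(3) p_gt_1 by (intro power_decreasing) auto
    with that show ?thesis by (simp add: absval_power)
  qed
  have "absval (x - y) \<le> 1"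
    using assms by (intro absval_diff_le) auto
  moreover have "\<rho> / real p \<le> 1" using assms p_gt_1 by (simp add: field_simps)
  ultimately have M: "0 \<le> M" "M \<le> 1" using \<rho> by (auto simp: M_def le_max_iff_disj)
  have v: "absval v \<le> absval (x - y) * M" using Suc.IH by (simp add: v_def M_def)
  also have "\<dots> \<le> absval (x - y) * 1" using M by (intro mult_left_mono) auto
  finally have v': "absval v \<le> absval (x - y)" by simp
  have "absval ((x ^ (p ^ h)) ^ p - (y ^ (p ^ h)) ^ p) \<le> absval v * max (\<rho> / real p) (absval v)"
    unfolding v_def by (intro absval_power_prime_diff_le le assms)
  moreover have "max (\<rho> / real p) (absval v) \<le> M"
    unfolding M_def by (intro max.mono order_refl v')
  then have "absval v * max (\<rho> / real p) (absval v) \<le> absval (x - y) * M"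
    using v' M by (intro mult_mono) (auto simp: le_max_iff_disj)
  ultimately show ?case unfolding M_def power_Suc2 power_mult by (rule order_trans)
qed

lemma exists_absval_less:
  assumes "0 < e"
  shows "\<exists>u::'a. u \<noteq> 0 \<and> absval u < e"
proof -
  obtain n where "(1 / real p) ^ n < e"
    using real_arch_pow_inv[of e "1 / real p"] assms p_gt_1 by auto
  then show ?thesis
    using p_gt_1 by (intro exI[of _ "of_nat p ^ n"]) (auto simp: absval_power absval_p)
qed

end

section \<open>LT-like series: coefficients, linear approximation and Newton's method\<close>

locale LT_series = Cp_field p ty for p and ty :: "'a::nonarch_field itself" +
  fixes q h :: nat and P :: "'a fps"
  assumes q: "q = p ^ h" and LT: "LT_like p q P"
begin

definition c :: real where "c = absval (fps_nth P 1)"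

abbreviation ev :: "'a \<Rightarrow> 'a" where "ev \<equiv> fps_value P"

lemma coeffs_le_P: "coeffs_le 1 P"
  using LT by (simp add: LT_like_def coeffs_le_1_iff)

lemma P_0: "fps_nth P 0 = 0"
  using LT by (simp add: LT_like_def)

text \<open>The condition that the valuation of the linear coefficient is at most 1 enters as
  \<open>1 / real p \<le> c\<close>: terms divisible by \<open>p\<close> are no larger than those
  divisible by the linear coefficient.\<close>

lemma c_bounds: "0 < c" "c < 1" "1 / real p \<le> c"
proof -
  have "fps_nth P 1 \<noteq> 0" using LT by (auto simp: LT_like_def val_def)
  then show c: "0 < c" by (simp add: c_def)
  have "0 < - log (real p) c" "- log (real p) c \<le> 1"
    using LT \<open>fps_nth P 1 \<noteq> 0\<close> by (auto simp: LT_like_def val_def c_def zero_ereal_def one_ereal_def)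
  then have "log (real p) c < 0" "-1 \<le> log (real p) c" by auto
  then have "c < real p powr 0" "real p powr -1 \<le> c"
    using c p_gt_1 by (auto simp: log_less_iff le_log_iff)
  then show "c < 1" "1 / real p \<le> c"
    using p_gt_1 by (auto simp: powr_minus_divide)
qed

lemma absval_P_q: "absval (fps_nth P q) = 1"
proof -
  obtain y where "absval (fps_nth P q) \<le> 1" "absval y \<le> 1" "fps_nth P q * y = 1"
    using LT by (auto simp: LT_like_def val_ring_units_def val_ring_def)
  moreover from this have "absval (fps_nth P q) * absval y = 1"
    by (metis absval_1 absval_mult)
  ultimately show ?thesis
    using mult_left_mono[of "absval y" 1 "absval (fps_nth P q)"] by simp
qed

text \<open>The coefficient of index 1 has absolute value \<open>c < 1\<close>, whereas the one of
  index \<open>q\<close> is a unit; hence \<open>q \<noteq> 1\<close>.\<close>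

lemma q_gt_1: "1 < q" and h_pos: "0 < h"
proof -
  have "q \<noteq> 1" using absval_P_q c_bounds by (auto simp: c_def)
  then show "0 < h" by (cases h) (auto simp: q)
  with p_gt_1 show "1 < q" unfolding q by (intro one_less_power)
qed

text \<open>Since \<open>q > 1\<close>, the term in \<open>X ^ q\<close> does not affect the
  coefficients of index 0 and 1; comparing these normalizes \<open>G\<close> to
  \<open>X + ...\<close>.\<close>

lemma P_decomp:
  obtains G where "coeffs_le 1 G" "fps_nth G 0 = 0" "fps_nth G 1 = 1"
    "P = fps_const (fps_nth P q) * fps_X ^ q + fps_const (fps_nth P 1) * G"
proof -
  obtain G where G: "coeffs_le 1 G"
      "P - fps_const (fps_nth P q) * fps_X ^ q = fps_const (fps_nth P 1) * G"
    using LT by (auto simp: LT_like_def coeffs_le_1_iff)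
  have nth: "fps_nth (P - fps_const (fps_nth P q) * fps_X ^ q) n = fps_nth P 1 * fps_nth G n" for n
    by (simp add: G(2))
  have "fps_nth P 1 \<noteq> 0" using c_bounds by (auto simp: c_def)
  then have "fps_nth G 0 = 0" "fps_nth G 1 = 1"
    using nth[of 0] nth[of 1] q_gt_1 P_0 by (auto simp: fps_X_power_nth)
  with G that show ?thesis by (metis add.commute diff_add_cancel)
qed

lemma absval_P_nth_less_1: "n \<noteq> q \<Longrightarrow> absval (fps_nth P n) < 1"
proof -
  assume n: "n \<noteq> q"
  obtain G where G: "coeffs_le 1 G"
     "P = fps_const (fps_nth P q) * fps_X ^ q + fps_const (fps_nth P 1) * G"
    using P_decomp by metis
  have "fps_nth P n = fps_nth P 1 * fps_nth G n"
    using n by (subst G(2)) (simp add: fps_X_power_nth)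
  also have "absval \<dots> \<le> c * 1"
    unfolding absval_mult c_def using coeffs_leD[OF G(1)] by (intro mult_left_mono) auto
  finally show ?thesis using c_bounds by simp
qed

text \<open>The difference of \<open>q\<close>-th powers contributes at most
  \<open>max (\<rho> / p) (absval (x - y))\<close> times the distance, and
  \<open>1 / p \<le> c\<close>. The rest is the linear coefficient times \<open>X * H\<close>, whose
  increments carry a factor \<open>\<rho>\<close>.\<close>

lemma ev_linear_approx:
  assumes x: "absval x \<le> \<rho>" and y: "absval y \<le> \<rho>" and \<rho>: "\<rho> < 1"
  shows "absval (ev x - ev y - fps_nth P 1 * (x - y)) \<le> absval (x - y) * max (c * \<rho>) (absval (x - y))"
proof -
  obtain G where G: "coeffs_le 1 G" "fps_nth G 0 = 0" "fps_nth G 1 = 1"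
     "P = fps_const (fps_nth P q) * fps_X ^ q + fps_const (fps_nth P 1) * G"
    using P_decomp by metis
  \<comment> \<open>Thus \<open>G = X + X * H\<close> with \<open>H\<close> vanishing at
    \<open>0\<close>.\<close>
  define H where "H = fps_shift 1 (G - fps_X)"
  have H: "coeffs_le 1 H" "fps_nth H 0 = 0"
    using G by (auto simp: H_def intro!: coeffs_le_shift coeffs_le_diff coeffs_le_X)
  have x1: "absval x < 1" and y1: "absval y < 1" using assms by auto
  have \<rho>0: "0 \<le> \<rho>" using x absval_nonneg order_trans by blast
  have evz: "ev z = fps_nth P q * z ^ q + fps_nth P 1 * (z + z * fps_value H z)" if z: "absval z < 1" for z
  proof -
    have Xq: "coeffs_le 1 (fps_X ^ q)" using coeffs_le_power[OF coeffs_le_X] by simp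
    have "ev z = fps_value (fps_const (fps_nth P q) * fps_X ^ q) z + fps_value (fps_const (fps_nth P 1) * G) z"
      by (subst G(4), rule fps_value_add[OF z])
         (rule coeffs_le_mult[OF coeffs_le_const[OF order_refl] Xq]
           coeffs_le_mult[OF coeffs_le_const[OF order_refl] G(1)])+
    also have "\<dots> = fps_nth P q * z ^ q + fps_nth P 1 * fps_value G z"
      using z by (simp add: fps_value_const_mult[OF z Xq] fps_value_const_mult[OF z G(1)]
          fps_value_power[OF z coeffs_le_X])
    also have "fps_value G z = z + fps_value (G - fps_X) z"
      using z by (simp add: fps_value_diff[OF z G(1) coeffs_le_X])
    also have "fps_value (G - fps_X) z = z * fps_value H z"
      using fps_value_rec[OF z coeffs_le_diff[OF G(1) coeffs_le_X]] G(2) by (simp add: H_def)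
    finally show ?thesis .
  qed
  have "ev x - ev y - fps_nth P 1 * (x - y) = fps_nth P q * (x ^ q - y ^ q) +
      fps_nth P 1 * ((x - y) * fps_value H x + y * (fps_value H x - fps_value H y))"
    by (simp add: evz x1 y1 algebra_simps)
  also have "absval \<dots> \<le> absval (x - y) * max (c * \<rho>) (absval (x - y))"
  proof (intro absval_add_le)
    have "\<rho> / real p \<le> c * \<rho>"
      using mult_right_mono[OF c_bounds(3) \<rho>0] by simp
    then have "absval (x - y) * max (\<rho> / real p) (absval (x - y)) \<le> absval (x - y) * max (c * \<rho>) (absval (x - y))"
      by (intro mult_left_mono max.mono) auto
    then show "absval (fps_nth P q * (x ^ q - y ^ q)) \<le> absval (x - y) * max (c * \<rho>) (absval (x - y))"
      using absval_power_prime_power_diff_le[OF x y \<rho> h_pos]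
      by (simp add: absval_mult absval_P_q flip: q)
    have "absval ((x - y) * fps_value H x) \<le> absval (x - y) * \<rho>"
      using absval_fps_value_le_arg[OF x1 H] x by (auto simp: absval_mult intro: mult_left_mono)
    moreover have "absval (y * (fps_value H x - fps_value H y)) \<le> \<rho> * absval (x - y)"
      using fps_value_lipschitz[OF H(1) x1 y1] y \<rho>0 by (auto simp: absval_mult intro: mult_mono)
    ultimately have "c * absval ((x - y) * fps_value H x + y * (fps_value H x - fps_value H y)) \<le>
        c * (absval (x - y) * \<rho>)"
      using c_bounds by (intro mult_left_mono absval_add_le) (auto simp: mult.commute)
    also have "\<dots> \<le> absval (x - y) * max (c * \<rho>) (absval (x - y))"
      unfolding mult.left_commute[of c] by (intro mult_left_mono) auto
    finally show "absval (fps_nth P 1 * ((x - y) * fps_value H x + y * (fps_value H x - fps_value H y)))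
        \<le> absval (x - y) * max (c * \<rho>) (absval (x - y))"
      by (simp add: absval_mult c_def)
  qed
  finally show ?thesis .
qed

text \<open>At distances below \<open>c\<close> the error of the linear approximation is strictly
  smaller than the linear term, so distances are scaled by exactly \<open>c\<close>.\<close>

lemma absval_ev_diff:
  assumes "absval x < 1" "absval y < 1" "absval (x - y) < c"
  shows "absval (ev x - ev y) = c * absval (x - y)"
proof (cases "x = y")
  case False
  define \<rho> where "\<rho> = max (absval x) (absval y)"
  have \<rho>: "\<rho> < 1" using assms by (simp add: \<rho>_def)
  have "absval (ev x - ev y - fps_nth P 1 * (x - y)) \<le> absval (x - y) * max (c * \<rho>) (absval (x - y))"
    using \<rho> by (intro ev_linear_approx) (auto simp: \<rho>_def)
  also have "\<dots> < absval (x - y) * c"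
    using False assms c_bounds \<rho> by (intro mult_strict_left_mono) auto
  finally have "absval (ev x - ev y) = absval (fps_nth P 1 * (x - y))"
    by (intro absval_eq_of_diff_less) (simp add: absval_mult c_def mult.commute)
  then show ?thesis by (simp add: absval_mult c_def)
qed auto

text \<open>Newton's method with the constant slope \<open>P' 0\<close> is a contraction.\<close>

lemma ev_newton:
  assumes x: "absval x < 1" and small: "absval (ev x - a) < c\<^sup>2"
  obtains w where "absval w < 1" "ev w = a" "absval (w - x) \<le> absval (ev x - a) / c"
proof -
  let ?p = "fps_nth P 1"
  \<comment> \<open>\<open>\<sigma>\<close> bounds the first Newton step and is the radius of the
    ball, \<open>\<rho>\<close> bounds the points of this ball, and \<open>\<theta>\<close> is the
    contraction factor obtained from \<open>ev_linear_approx\<close> after division by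
    \<open>c\<close>. The bound \<open>c\<^sup>2\<close> on the residue gives
    \<open>\<sigma> / c < 1\<close>.\<close>
  define \<sigma> where "\<sigma> = absval (ev x - a) / c"
  define \<rho> where "\<rho> = max (absval x) \<sigma>"
  define \<theta> where "\<theta> = max \<rho> (\<sigma> / c)"
  define T where "T = (\<lambda>y. y - (ev y - a) / ?p)"
  have p0: "?p \<noteq> 0" using c_bounds by (auto simp: c_def)
  have \<sigma>: "0 \<le> \<sigma>" "\<sigma> < c"
    using small c_bounds by (auto simp: \<sigma>_def divide_less_eq power2_eq_square)
  then have \<rho>: "0 \<le> \<rho>" "\<rho> < 1" using x c_bounds by (auto simp: \<rho>_def)
  have \<theta>: "0 \<le> \<theta>" "\<theta> < 1" using \<rho> \<sigma> c_bounds by (auto simp: \<theta>_def divide_less_eq)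
  have ball: "y \<in> cball x \<sigma> \<longleftrightarrow> absval (y - x) \<le> \<sigma>" for y
    by (simp add: dist_absval absval_minus_commute)
  have y\<rho>: "absval y \<le> \<rho>" if "y \<in> cball x \<sigma>" for y
  proof -
    have "absval (y - x + x) \<le> \<rho>"
      using that unfolding ball by (intro absval_add_le) (auto simp: \<rho>_def le_max_iff_disj)
    then show ?thesis by simp
  qed
  have contr: "absval (T y - T z) \<le> \<theta> * absval (y - z)" if "y \<in> cball x \<sigma>" "z \<in> cball x \<sigma>" for y z
  proof -
    have "absval ((y - x) - (z - x)) \<le> \<sigma>" using that unfolding ball by (rule absval_diff_le)
    then have yz: "absval (y - z) \<le> \<sigma>" by simp
    have "T y - T z = - (ev y - ev z - ?p * (y - z)) / ?p"
      using p0 by (simp add: T_def field_simps)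
    then have "absval (T y - T z) = absval (ev y - ev z - ?p * (y - z)) / c"
      by (simp only: absval_divide absval_minus c_def)
    also have "\<dots> \<le> absval (y - z) * max (c * \<rho>) (absval (y - z)) / c"
      using that \<rho> c_bounds by (intro divide_right_mono ev_linear_approx y\<rho>) auto
    also have "\<dots> \<le> absval (y - z) * (c * \<theta>) / c"
    proof (intro divide_right_mono mult_left_mono)
      have "\<sigma> \<le> c * \<theta>" using c_bounds mult_left_mono[of "\<sigma> / c" \<theta> c] by (simp add: \<theta>_def)
      moreover have "c * \<rho> \<le> c * \<theta>" using c_bounds by (simp add: \<theta>_def)
      ultimately show "max (c * \<rho>) (absval (y - z)) \<le> c * \<theta>" using yz by simp
    qed (use c_bounds in auto)
    finally show ?thesis using c_bounds by (simp add: mult.commute)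
  qed
  have xin: "x \<in> cball x \<sigma>" using \<sigma> by simp
  have "\<exists>!w\<in>cball x \<sigma>. T w = w"
  proof (rule Banach_fix[OF _ _ \<theta>])
    show "complete (cball x \<sigma>)"
      using complete_ty complete_closed_subset by blast
    show "T ` cball x \<sigma> \<subseteq> cball x \<sigma>"
    proof
      fix w assume "w \<in> T ` cball x \<sigma>"
      then obtain y where y: "y \<in> cball x \<sigma>" "w = T y" by auto
      have "absval (T y - T x) \<le> \<theta> * absval (y - x)" using contr[OF y(1) xin] .
      also have "\<dots> \<le> 1 * \<sigma>" using y \<theta> ball by (intro mult_mono) auto
      finally have "absval (T y - T x) \<le> \<sigma>" by simp
      moreover have "absval (T x - x) \<le> \<sigma>"
        by (simp add: T_def absval_divide \<sigma>_def c_def)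
      ultimately have "absval (T y - T x + (T x - x)) \<le> \<sigma>" by (rule absval_add_le)
      then show "w \<in> cball x \<sigma>" unfolding ball y(2) by simp
    qed
  qed (use xin contr in \<open>auto simp: dist_absval\<close>)
  then obtain w where w: "w \<in> cball x \<sigma>" "T w = w" by blast
  then have "ev w = a" using p0 by (simp add: T_def)
  moreover have "absval w < 1" using y\<rho>[OF w(1)] \<rho> by simp
  moreover have "absval (w - x) \<le> absval (ev x - a) / c"
    using w(1)[unfolded ball] unfolding \<sigma>_def .
  ultimately show thesis using that by simp
qed

end

text \<open>Modulo the maximal ideal, multiplication by \<open>X - w\<close> is multiplication by \<open>X\<close>.\<close>

lemma coeff_prod_X_minus_const:
  fixes R :: "'a::nonarch_field fps"
  assumes "finite W" "\<And>w. w \<in> W \<Longrightarrow> absval w < 1" "coeffs_le 1 R"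
  shows "absval (fps_nth ((\<Prod>w\<in>W. fps_X - fps_const w) * R) (n + card W) - fps_nth R n) < 1"
  using assms
proof (induction W arbitrary: n rule: finite_induct)
  case (insert w W)
  define F where "F = (\<Prod>w\<in>W. fps_X - fps_const w) * R"
  have F: "coeffs_le 1 F"
    unfolding F_def mult.commute[of _ R] using insert.prems
    by (intro coeffs_le_mult_1 coeffs_le_prod_1 coeffs_le_X_minus_const) (auto intro: less_imp_le)
  have "absval w * absval (fps_nth F (Suc (n + card W))) \<le> absval w * 1"
    using coeffs_leD[OF F] by (intro mult_left_mono) auto
  also have "\<dots> < 1" using insert.prems by simp
  finally have "absval (w * fps_nth F (Suc (n + card W))) < 1" by (simp add: absval_mult)
  moreover have "absval (fps_nth F (n + card W) - fps_nth R n) < 1"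
    using insert.IH[of n] insert.prems by (simp add: F_def)
  ultimately have "absval (fps_nth F (n + card W) - fps_nth R n - w * fps_nth F (Suc (n + card W))) < 1"
    by (rule absval_diff_less[rotated])
  then have "absval (fps_nth F (n + card W) - w * fps_nth F (Suc (n + card W)) - fps_nth R n) < 1"
    by (simp add: algebra_simps)
  moreover have "(\<Prod>w\<in>insert w W. fps_X - fps_const w) * R = (fps_X - fps_const w) * F"
    using insert.hyps by (simp add: F_def mult.assoc)
  moreover have "fps_nth ((fps_X - fps_const w) * F) (Suc m) = fps_nth F m - w * fps_nth F (Suc m)" for m
    by (simp add: left_diff_distrib fps_X_mult_nth)
  moreover have "n + card (insert w W) = Suc (n + card W)" using insert.hyps by simp
  ultimately show ?case by simp
qed auto

section \<open>Fibres of the map \<open>ev\<close> over points of the open disk\<close>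

context LT_series
begin

lemma ev_0 [simp]: "ev 0 = 0"
  using fps_value_rec[OF _ coeffs_le_P, of 0] P_0 by simp

lemma absval_ev_less_1: "absval z < 1 \<Longrightarrow> absval (ev z) < 1"
  using absval_fps_value_le_arg[OF _ coeffs_le_P P_0, of z] by simp

definition fiber :: "'a \<Rightarrow> 'a set" where
  "fiber a = {z. absval z < 1 \<and> ev z = a}"

text \<open>Modulo the maximal ideal, \<open>P - a\<close> is a unit times \<open>X ^ q\<close> and
  the product over \<open>W\<close> is \<open>X ^ card W\<close>. So the quotient \<open>R\<close>
  reduces to a unit times \<open>X ^ (q - card W)\<close> when
  \<open>card W \<le> q\<close>.\<close>

lemma fiber_factor:
  assumes a: "absval a < 1" and W: "finite W" "W \<subseteq> fiber a"
  obtains R where "coeffs_le 1 R"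
    "\<And>z. absval z < 1 \<Longrightarrow> ev z - a = (\<Prod>w\<in>W. z - w) * fps_value R z"
    "card W < q \<Longrightarrow> absval (fps_nth R 0) < 1"
    "card W \<le> q \<Longrightarrow> absval (fps_nth R (q - card W)) = 1"
proof -
  define F where "F = P - fps_const a"
  have F: "coeffs_le 1 F"
    using a by (auto simp: F_def intro!: coeffs_le_diff coeffs_le_P coeffs_le_const)
  have evF: "fps_value F z = ev z - a" if "absval z < 1" for z
    using fps_value_diff[OF that coeffs_le_P coeffs_le_const[OF order_refl], of a] that
    by (simp add: F_def)
  have W1: "absval w < 1" if "w \<in> W" for w using that W by (auto simp: fiber_def)
  have "\<exists>R. coeffs_le 1 R \<and> F = (\<Prod>w\<in>W. fps_X - fps_const w) * R"
    using W by (intro fps_value_zeros_factor F) (auto simp: evF fiber_def)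
  then obtain R where R: "coeffs_le 1 R" "F = (\<Prod>w\<in>W. fps_X - fps_const w) * R" by blast
  have X: "coeffs_le 1 (fps_X - fps_const w)" if "w \<in> W" for w
    using W1[OF that] by (intro coeffs_le_X_minus_const) simp
  have nth: "absval (fps_nth F (n + card W) - fps_nth R n) < 1" for n
    unfolding R(2) using W W1 R(1) by (intro coeff_prod_X_minus_const) auto
  show thesis
  proof
    show "ev z - a = (\<Prod>w\<in>W. z - w) * fps_value R z" if z: "absval z < 1" for z
    proof -
      have "fps_value (\<Prod>w\<in>W. fps_X - fps_const w) z = (\<Prod>w\<in>W. z - w)"
        using z by (subst fps_value_prod[OF z X]) auto
      moreover have "coeffs_le 1 (\<Prod>w\<in>W. fps_X - fps_const w)"
        using X by (rule coeffs_le_prod_1)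
      ultimately show ?thesis
        using fps_value_mult[OF z _ R(1), of 1 "\<Prod>w\<in>W. fps_X - fps_const w"] evF[OF z] R(2) by simp
    qed
    show "absval (fps_nth R 0) < 1" if "card W < q"
    proof -
      have "absval (fps_nth F (card W)) < 1"
        using that a P_0 absval_P_nth_less_1[of "card W"] by (cases "card W = 0") (auto simp: F_def)
      from absval_diff_less[OF this] nth[of 0] show ?thesis by fastforce
    qed
    show "absval (fps_nth R (q - card W)) = 1" if "card W \<le> q"
    proof -
      have "absval (fps_nth F q) = 1"
        using q_gt_1 absval_P_q by (simp add: F_def)
      then show ?thesis
        using nth[of "q - card W"] that
        by (metis absval_eq_of_diff_less absval_minus_commute le_add_diff_inverse2)
    qed
  qed (rule R(1))
qed

text \<open>As long as \<open>card W < q\<close>, the quotient \<open>R\<close> has a non-unit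
  constant term and a unit coefficient of positive index, hence an approximate zero in the disk.
  Newton's method turns this into an exact preimage of \<open>a\<close>.\<close>

lemma fiber_extend:
  assumes a: "absval a < 1" and W: "finite W" "W \<subseteq> fiber a" "card W < q"
  shows "\<exists>w\<in>fiber a. w \<notin> W"
proof -
  obtain R where R: "coeffs_le 1 R"
    "\<And>z. absval z < 1 \<Longrightarrow> ev z - a = (\<Prod>w\<in>W. z - w) * fps_value R z"
    "absval (fps_nth R 0) < 1" "absval (fps_nth R (q - card W)) = 1"
    using fiber_factor[OF a W(1,2)] W(3) by (metis less_imp_le)
  have W1: "absval w < 1" if "w \<in> W" for w using that W by (auto simp: fiber_def)
  have prod1: "(\<Prod>w\<in>V. absval (z - w)) \<le> 1" if "absval z < 1" "V \<subseteq> W" for z V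
  proof (rule prod_le_1, rule conjI)
    show "absval (z - w) \<le> 1" if "w \<in> V" for w
      using that W1[of w] \<open>absval z < 1\<close> \<open>V \<subseteq> W\<close> by (intro absval_diff_le) auto
  qed simp
  obtain t :: 'a where t: "absval t < 1" "absval (fps_nth R 0) < absval t ^ (q - card W)"
    using exists_absval_power_gt[OF R(3), of "q - card W"] W(3) by auto
  \<comment> \<open>Below \<open>c\<^sup>2\<close>, so that Newton's method applies, and below
    \<open>c\<close>, so that \<open>c \<le> e\<close> is a contradiction.\<close>
  define e where "e = c\<^sup>2 / 2"
  have "c * c < c * 1" using c_bounds by (intro mult_strict_left_mono) auto
  then have e: "0 < e" "e < c\<^sup>2" "e < c"
    using c_bounds by (auto simp: e_def power2_eq_square)
  obtain x where "absval x < absval t" "absval (fps_value R x) \<le> e"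
    using approx_zero_in_disk[OF R(1) t(1), of "q - card W" e] t e R(4) by auto
  then have x: "absval x < 1" "absval (fps_value R x) \<le> e" using t by auto
  have "absval (ev x - a) \<le> 1 * e"
    unfolding R(2)[OF x(1)] absval_mult absval_prod
    using x by (intro mult_mono prod1) auto
  then have ex: "absval (ev x - a) \<le> e" by simp
  then obtain w where w: "absval w < 1" "ev w = a" "absval (w - x) \<le> absval (ev x - a) / c"
    using ev_newton[OF x(1), of a] e by auto
  have "absval (ev x - a) / c < c"
    using ex e c_bounds by (simp add: divide_less_eq power2_eq_square)
  then have wx: "absval (w - x) < c" using w by simp
  \<comment> \<open>Simplicity of the zeros: near \<open>w\<close> the value \<open>ev y - a\<close>
    has absolute value exactly \<open>c * absval (y - w)\<close>, but if \<open>w\<close> were in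
    \<open>W\<close>, a small value of \<open>R\<close> would make it at most
    \<open>e * absval (y - w)\<close>.\<close>
  have "w \<notin> W"
  proof
    assume wW: "w \<in> W"
    obtain u :: 'a where u: "u \<noteq> 0" "absval u < e" using exists_absval_less e by blast
    \<comment> \<open>The factor \<open>absval (y - w)\<close> is to be cancelled, so
      \<open>y\<close> must differ from \<open>w\<close>; the shift by \<open>u\<close> is small
      enough to keep \<open>R\<close> bounded by \<open>e\<close>.\<close>
    define y where "y = (if x = w then w + u else x)"
    have y: "absval y < 1" "absval (y - w) < c" "y \<noteq> w" "absval (fps_value R y) \<le> e"
    proof -
      show y1: "absval y < 1" using x w u e c_bounds by (auto simp: y_def intro: absval_add_less)
      show "absval (y - w) < c" using wx u e by (auto simp: y_def absval_minus_commute)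
      show "y \<noteq> w" using u by (auto simp: y_def)
      have "absval (y - x) \<le> e" using u e by (auto simp: y_def)
      then have "absval (fps_value R y - fps_value R x) \<le> e"
        using fps_value_lipschitz[OF R(1) y1 x(1)] by simp
      from absval_add_le[OF this x(2)] show "absval (fps_value R y) \<le> e" by simp
    qed
    have "c * absval (y - w) = absval (ev y - a)"
      using absval_ev_diff[OF y(1) w(1) y(2)] w by simp
    also have "\<dots> = absval (y - w) * (\<Prod>v\<in>W - {w}. absval (y - v)) * absval (fps_value R y)"
      unfolding R(2)[OF y(1)] absval_mult absval_prod using wW W by (simp add: prod.remove)
    also have "\<dots> \<le> absval (y - w) * 1 * e"
      using y prod1[of y "W - {w}"] by (intro mult_mono) (auto intro!: prod_nonneg)
    finally have "c \<le> e" using y by (simp add: mult.commute)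
    with e show False by simp
  qed
  with w show ?thesis by (auto simp: fiber_def)
qed

text \<open>Repeated extension yields \<open>q\<close> preimages. For these the constant term of
  \<open>R\<close> is a unit, so \<open>R\<close> has absolute value 1 on the whole disk; this gives
  the product formula and leaves no further preimage.\<close>

lemma fiber_prod:
  assumes a: "absval a < 1"
  shows "finite (fiber a)" "card (fiber a) = q"
    "absval z < 1 \<Longrightarrow> absval (ev z - a) = (\<Prod>w\<in>fiber a. absval (z - w))"
proof -
  have "\<exists>W. finite W \<and> W \<subseteq> fiber a \<and> card W = m" if "m \<le> q" for m
    using that
  proof (induction m)
    case (Suc m)
    then obtain W where W: "finite W" "W \<subseteq> fiber a" "card W = m" by auto
    with fiber_extend[OF a W(1,2)] Suc.prems obtain w where "w \<in> fiber a" "w \<notin> W" by auto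
    with W show ?case by (intro exI[of _ "insert w W"]) auto
  qed (auto intro: exI[of _ "{}"])
  then obtain W where W: "finite W" "W \<subseteq> fiber a" "card W = q" by blast
  obtain R where R: "coeffs_le 1 R"
    "\<And>z. absval z < 1 \<Longrightarrow> ev z - a = (\<Prod>w\<in>W. z - w) * fps_value R z"
    "absval (fps_nth R 0) = 1"
    using fiber_factor[OF a W(1,2)] W(3) by (metis diff_self_eq_0 order_refl)
  have prod: "absval (ev z - a) = (\<Prod>w\<in>W. absval (z - w))" if z: "absval z < 1" for z
  proof -
    have "fps_value R z - fps_nth R 0 = z * fps_value (fps_shift 1 R) z"
      using fps_value_rec[OF z R(1)] by simp
    also have "absval \<dots> \<le> absval z * 1"
      unfolding absval_mult
      by (intro mult_left_mono absval_fps_value_le coeffs_le_shift R(1) z) simp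
    finally have "absval (fps_value R z) = 1"
      using z R(3) absval_eq_of_diff_less[of "fps_value R z" "fps_nth R 0"] by simp
    then show ?thesis using R(2)[OF z] by (simp add: absval_mult absval_prod)
  qed
  have "fiber a = W"
  proof (intro antisym subsetI)
    fix v assume "v \<in> fiber a"
    then have "(\<Prod>w\<in>W. absval (v - w)) = 0" using prod[of v] by (simp add: fiber_def)
    then show "v \<in> W" using W(1) by auto
  qed (use W in auto)
  with W prod show "finite (fiber a)" "card (fiber a) = q"
    "absval z < 1 \<Longrightarrow> absval (ev z - a) = (\<Prod>w\<in>fiber a. absval (z - w))" by auto
qed

section \<open>Zeros of the iterates\<close>

definition zeros :: "nat \<Rightarrow> 'a set" where
  "zeros n = {z. absval z < 1 \<and> (ev ^^ n) z = 0}"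

lemma absval_iterate_less_1: "absval z < 1 \<Longrightarrow> absval ((ev ^^ n) z) < 1"
  by (induction n) (auto simp: absval_ev_less_1)

lemma iterate_0 [simp]: "(ev ^^ n) 0 = 0"
  by (induction n) auto

lemma zeros_Suc: "zeros (Suc n) = (\<Union>a\<in>zeros n. fiber a)"
  by (auto simp: zeros_def fiber_def funpow_Suc_right absval_ev_less_1 simp del: funpow.simps)

text \<open>The zeros of the next iterate are the disjoint union of the fibres over the zeros of the
  \<open>n\<close>-th one. Applying the formula for \<open>n\<close> at \<open>ev z\<close> and
  \<open>fiber_prod\<close> to each factor gives the formula for \<open>Suc n\<close>.\<close>

lemma zeros_prod:
  shows "finite (zeros n)" "card (zeros n) = q ^ n"
    "absval z < 1 \<Longrightarrow> absval ((ev ^^ n) z) = (\<Prod>w\<in>zeros n. absval (z - w))"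
proof (induction n arbitrary: z)
  case 0
  have "zeros 0 = {0}" by (auto simp: zeros_def)
  then show "finite (zeros 0)" "card (zeros 0) = q ^ 0"
    "absval ((ev ^^ 0) z) = (\<Prod>w\<in>zeros 0. absval (z - w))" for z by auto
next
  case (Suc n)
  have z1: "absval a < 1" if "a \<in> zeros n" for a using that by (simp add: zeros_def)
  have disj: "\<forall>a\<in>zeros n. \<forall>b\<in>zeros n. a \<noteq> b \<longrightarrow> fiber a \<inter> fiber b = {}"
    by (auto simp: fiber_def)
  have fin: "\<forall>a\<in>zeros n. finite (fiber a)" using fiber_prod(1) z1 by blast
  show "finite (zeros (Suc n))" using Suc.IH(1) fin by (simp add: zeros_Suc)
  show "card (zeros (Suc n)) = q ^ Suc n"
    unfolding zeros_Suc
    by (subst card_UN_disjoint[OF Suc.IH(1) fin disj]) (simp add: fiber_prod(2) z1 Suc.IH(2))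
  fix z :: 'a assume z: "absval z < 1"
  have "absval ((ev ^^ Suc n) z) = absval ((ev ^^ n) (ev z))"
    by (simp add: funpow_Suc_right del: funpow.simps)
  also have "\<dots> = (\<Prod>a\<in>zeros n. absval (ev z - a))"
    using Suc.IH(3) absval_ev_less_1[OF z] by blast
  also have "\<dots> = (\<Prod>a\<in>zeros n. \<Prod>w\<in>fiber a. absval (z - w))"
    using z1 z by (intro prod.cong fiber_prod(3)) auto
  also have "\<dots> = (\<Prod>w\<in>zeros (Suc n). absval (z - w))"
    unfolding zeros_Suc by (rule prod.UNION_disjoint[OF Suc.IH(1) fin disj, symmetric])
  finally show "absval ((ev ^^ Suc n) z) = (\<Prod>w\<in>zeros (Suc n). absval (z - w))" .
qed

lemma absval_iterate_diff:
  assumes "absval x < 1" "absval y < 1" "absval (x - y) < c"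
  shows "absval ((ev ^^ n) x - (ev ^^ n) y) = c ^ n * absval (x - y)"
proof (induction n)
  case (Suc n)
  have "c ^ n * absval (x - y) \<le> 1 * absval (x - y)"
    using c_bounds by (intro mult_right_mono power_le_one) auto
  then have "absval ((ev ^^ n) x - (ev ^^ n) y) < c" using assms Suc by simp
  then show ?case
    using Suc by (simp add: absval_ev_diff absval_iterate_less_1 assms)
qed auto

text \<open>Both sides are the absolute value of the derivative of the \<open>n\<close>-th iterate
  at \<open>w\<close>. It is read off from the value at \<open>w + u\<close> for tiny
  \<open>u\<close>, once by the scaling of distances and once by the product formula.\<close>

lemma zeros_separation:
  assumes w: "w \<in> zeros n"
  shows "(\<Prod>v\<in>zeros n - {w}. absval (w - v)) = c ^ n"
proof -
  \<comment> \<open>Below \<open>c\<close>, \<open>absval_iterate_diff\<close> applies; below the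
    distance to every other zero, adding \<open>u\<close> does not change
    \<open>absval (w - v)\<close>.\<close>
  define e where "e = Min (insert c ((\<lambda>v. absval (w - v)) ` (zeros n - {w})))"
  have e: "0 < e" "e \<le> c" "\<And>v. v \<in> zeros n - {w} \<Longrightarrow> e \<le> absval (w - v)"
    using c_bounds zeros_prod(1)[of n] by (auto simp: e_def)
  obtain u :: 'a where u: "u \<noteq> 0" "absval u < e" using exists_absval_less[OF e(1)] by blast
  have w1: "absval w < 1" "(ev ^^ n) w = 0" using w by (auto simp: zeros_def)
  have wu: "absval (w + u) < 1" using w1 u e c_bounds by (intro absval_add_less) auto
  have "c ^ n * absval u = absval ((ev ^^ n) (w + u))"
    using absval_iterate_diff[OF wu w1(1), of n] w1 u e by simp
  also have "\<dots> = absval u * (\<Prod>v\<in>zeros n - {w}. absval (w + u - v))"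
    using zeros_prod(3)[OF wu, of n] zeros_prod(1)[of n] w by (simp add: prod.remove)
  also have "(\<Prod>v\<in>zeros n - {w}. absval (w + u - v)) = (\<Prod>v\<in>zeros n - {w}. absval (w - v))"
  proof (rule prod.cong[OF refl])
    fix v assume "v \<in> zeros n - {w}"
    then have "absval u < absval (w - v)" using e(3) u by fastforce
    from absval_add_eq[OF this] show "absval (w + u - v) = absval (w - v)"
      by (simp add: algebra_simps)
  qed
  finally show ?thesis using u by simp
qed

text \<open>For \<open>absval y \<le> s\<close>, both the linear term at \<open>y\<close> and the
  error of the linear approximation between \<open>y\<close> and \<open>0\<close> are at most
  \<open>s * absval y\<close>.\<close>

lemma absval_iterate_le:
  assumes "absval z \<le> s" "c \<le> s" "s < 1"
  shows "absval ((ev ^^ n) z) \<le> s ^ n * absval z"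
proof (induction n)
  case (Suc n)
  define y where "y = (ev ^^ n) z"
  have s: "0 \<le> s" using assms c_bounds by simp
  have "s ^ n * absval z \<le> 1 * absval z"
    using assms s by (intro mult_right_mono power_le_one) auto
  with Suc assms have y: "absval y \<le> s" by (simp add: y_def)
  have "absval (ev y - ev 0 - fps_nth P 1 * (y - 0)) \<le> absval (y - 0) * max (c * s) (absval (y - 0))"
    using y assms s by (intro ev_linear_approx) auto
  also have "\<dots> \<le> absval y * s"
    using y assms c_bounds s mult_right_mono[of c 1 s]
    by (intro mult_mono) (auto simp: le_max_iff_disj)
  finally have "absval (ev y - fps_nth P 1 * y) \<le> s * absval y" by (simp add: mult.commute)
  moreover have "absval (fps_nth P 1 * y) \<le> s * absval y"
    using assms by (auto simp: absval_mult c_def intro: mult_right_mono)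
  ultimately have "absval (ev y - fps_nth P 1 * y + fps_nth P 1 * y) \<le> s * absval y"
    by (rule absval_add_le)
  also have "\<dots> \<le> s * (s ^ n * absval z)" using Suc s by (intro mult_left_mono) (auto simp: y_def)
  finally show ?case by (simp add: y_def mult.assoc)
qed auto

lemma iterate_uniformly_small:
  assumes "r < 1"
  shows "\<exists>N. \<forall>z. absval z \<le> r \<longrightarrow> absval ((ev ^^ N) z) < c"
proof -
  define s where "s = max r c"
  have s: "c \<le> s" "r \<le> s" "s < 1" "0 \<le> s" using assms c_bounds by (auto simp: s_def)
  obtain N where N: "s ^ N < c" using real_arch_pow_inv[of c s] c_bounds s by blast
  have "absval ((ev ^^ N) z) < c" if "absval z \<le> r" for z
  proof -
    have "absval ((ev ^^ N) z) \<le> s ^ N * absval z"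
      using that s by (intro absval_iterate_le) auto
    also have "\<dots> \<le> s ^ N * 1" using that s by (intro mult_left_mono) auto
    finally show ?thesis using N by simp
  qed
  then show ?thesis by blast
qed

text \<open>Once the orbit has entered the ball of radius \<open>c\<close>, every step contracts by
  \<open>c\<close>; the constant \<open>1 / c ^ N\<close> pays for the first \<open>N\<close>
  steps.\<close>

lemma iterate_decay:
  assumes "absval z < 1"
  shows "\<exists>C>0. \<forall>n. absval ((ev ^^ n) z) \<le> C * c ^ n"
proof -
  obtain N where N: "absval ((ev ^^ N) z) < c" using iterate_uniformly_small[OF assms] by blast
  have "absval ((ev ^^ n) z) \<le> c ^ n / c ^ N" for n
  proof (cases "n \<le> N")
    case True
    then have "c ^ N \<le> c ^ n" using c_bounds by (intro power_decreasing) auto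
    then have "1 \<le> c ^ n / c ^ N" using c_bounds by simp
    then show ?thesis using absval_iterate_less_1[OF assms, of n] by linarith
  next
    case False
    define m where "m = n - N"
    have n: "n = m + N" using False by (simp add: m_def)
    have "absval ((ev ^^ m) ((ev ^^ N) z)) \<le> c ^ m * absval ((ev ^^ N) z)"
      using N c_bounds by (intro absval_iterate_le) auto
    also have "\<dots> \<le> c ^ m * 1"
      using N c_bounds by (intro mult_left_mono) auto
    finally show ?thesis using c_bounds by (simp add: n funpow_add power_add)
  qed
  then show ?thesis using c_bounds by (intro exI[of _ "1 / c ^ N"]) (auto simp: field_simps)
qed

lemma zeros_mono: "m \<le> n \<Longrightarrow> zeros m \<subseteq> zeros n"
  by (auto simp: zeros_def funpow_add dest!: le_Suc_ex simp flip: add.commute)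

text \<open>A uniform \<open>N\<close> carries the smaller disk into the ball of radius
  \<open>c\<close>. There iterates scale the distance to \<open>0\<close> by powers of
  \<open>c\<close>, so \<open>0\<close> is their only zero, and every zero in the smaller disk
  already lies in \<open>zeros N\<close>.\<close>

lemma finite_zeros_in_smaller_disk:
  assumes "r < 1"
  shows "finite {z \<in> \<Union>n. zeros n. absval z \<le> r}"
proof -
  obtain N where N: "\<And>z. absval z \<le> r \<Longrightarrow> absval ((ev ^^ N) z) < c"
    using iterate_uniformly_small[OF assms] by blast
  have "z \<in> zeros N" if z: "z \<in> zeros n" "absval z \<le> r" for z n
  proof (cases "n \<le> N")
    case True
    then show ?thesis using zeros_mono z by blast
  next
    case False
    define m where "m = n - N"
    have n: "n = m + N" using False by (simp add: m_def)
    define y where "y = (ev ^^ N) z"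
    have "absval y < c" using N z by (simp add: y_def)
    moreover have "(ev ^^ m) y = 0" using z by (simp add: zeros_def n funpow_add y_def)
    ultimately have "c ^ m * absval y = 0"
      using absval_iterate_diff[of y 0 m] c_bounds by simp
    then show ?thesis using z c_bounds by (simp add: zeros_def y_def)
  qed
  then show ?thesis using zeros_prod(1)[of N] by (auto intro: finite_subset[of _ "zeros N"])
qed

lemma infinite_zeros: "infinite (\<Union>n. zeros n)"
proof
  assume "finite (\<Union>n. zeros n)"
  then have "q ^ n \<le> card (\<Union>n. zeros n)" for n
    unfolding zeros_prod(2)[symmetric] by (intro card_mono) auto
  moreover have "n < q ^ n" for n using q_gt_1 by (simp add: power_gt_expt)
  ultimately show False by (meson not_less order_refl order_trans)
qed

text \<open>The passage from formal composition to iteration of the map \<open>ev\<close>;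
  integrality and the vanishing constant term are carried along because
  \<open>fps_value_compose\<close> asks for them.\<close>

lemma fps_iterate_props:
  shows "coeffs_le 1 (fps_iterate P n)" "fps_nth (fps_iterate P n) 0 = 0"
    "absval z < 1 \<Longrightarrow> fps_value (fps_iterate P n) z = (ev ^^ n) z"
proof -
  have rec: "fps_iterate P 0 = fps_X" "fps_iterate P (Suc n) = P oo fps_iterate P n" for n
    by (simp_all add: fps_iterate_def)
  have *: "coeffs_le 1 (fps_iterate P n) \<and> fps_nth (fps_iterate P n) 0 = 0" for n
    by (induction n) (auto simp: rec coeffs_le_X coeffs_le_compose coeffs_le_P P_0)
  then show "coeffs_le 1 (fps_iterate P n)" "fps_nth (fps_iterate P n) 0 = 0" by auto
  assume z: "absval z < 1"
  show "fps_value (fps_iterate P n) z = (ev ^^ n) z"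
    using * by (induction n) (auto simp: rec z fps_value_compose[OF z coeffs_le_P])
qed

lemma Lambda_set_eq: "Lambda_set P = (\<Union>n. zeros n)"
  by (auto simp: Lambda_set_def open_disk_def zeros_def fps_iterate_props(3))

end

section \<open>Interpolation at the zeros of the iterates\<close>

text \<open>The Lagrange interpolant \<open>L\<close> of \<open>f\<close> at \<open>W\<close> has
  coefficients at most \<open>M / d\<close>. The difference \<open>f - L\<close> is divisible by the
  product of the \<open>X - w\<close>, with a quotient bounded by \<open>max B (M / d)\<close>; at
  \<open>z\<close> this product has absolute value at most 1.\<close>

lemma (in complete_nonarch) interpolation_bound:
  fixes f :: "'a fps"
  assumes W: "finite W" "\<And>w. w \<in> W \<Longrightarrow> absval w < 1"
    and f: "coeffs_le B f" and M: "0 \<le> M" "\<And>w. w \<in> W \<Longrightarrow> absval (fps_value f w) \<le> M"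
    and d: "0 < d" "\<And>w. w \<in> W \<Longrightarrow> d \<le> (\<Prod>v\<in>W - {w}. absval (w - v))"
    and z: "absval z < 1"
  shows "absval (fps_value f z) \<le> max (B * (\<Prod>w\<in>W. absval (z - w))) (M / d)"
proof -
  define a where "a w = fps_value f w / (\<Prod>v\<in>W - {w}. w - v)" for w
  define l where "l w = fps_const (a w) * (\<Prod>v\<in>W - {w}. fps_X - fps_const v)" for w
  define L where "L = (\<Sum>w\<in>W. l w)"
  have X: "coeffs_le 1 (fps_X - fps_const v)" if "v \<in> W" for v
    using W(2)[OF that] by (intro coeffs_le_X_minus_const) simp
  have a: "absval (a w) \<le> M / d" if "w \<in> W" for w
    unfolding a_def absval_divide absval_prod using M d that by (intro frac_le) auto
  have Xp: "coeffs_le 1 (\<Prod>v\<in>W - {w}. fps_X - fps_const v)" for w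
    using X by (intro coeffs_le_prod_1) auto
  have l: "coeffs_le (M / d) (l w)" if "w \<in> W" for w
    unfolding l_def using a[OF that] by (intro coeffs_le_mult_1 coeffs_le_const Xp)
  have Md: "0 \<le> M / d" using M d by simp
  have L: "coeffs_le (M / d) L" unfolding L_def by (intro coeffs_le_sum l Md)
  have Lval: "fps_value L x = (\<Sum>w\<in>W. a w * (\<Prod>v\<in>W - {w}. x - v))" if x: "absval x < 1" for x
  proof -
    have "fps_value (l w) x = a w * (\<Prod>v\<in>W - {w}. x - v)" for w
      unfolding l_def fps_value_const_mult[OF x Xp]
      using x X by (subst fps_value_prod[OF x]) auto
    then show ?thesis unfolding L_def by (subst fps_value_sum[OF x l Md]) auto
  qed
  have Lw: "fps_value L w = fps_value f w" if w: "w \<in> W" for w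
  proof -
    have "fps_value L w = (\<Sum>u\<in>{w}. a u * (\<Prod>v\<in>W - {u}. w - v))"
      unfolding Lval[OF W(2)[OF w]]
    proof (rule sum.mono_neutral_right[OF W(1)])
      show "\<forall>u\<in>W - {w}. a u * (\<Prod>v\<in>W - {u}. w - v) = 0"
        using w W(1) by (auto simp: prod_zero_iff)
    qed (use w in auto)
    then show ?thesis using W(1) by (simp add: a_def)
  qed
  define N where "N = max B (M / d)"
  have F: "coeffs_le N (f - L)"
    by (intro coeffs_le_diff coeffs_le_mono[OF f] coeffs_le_mono[OF L]) (auto simp: N_def)
  have "fps_value (f - L) w = 0" if "w \<in> W" for w
    using fps_value_diff[OF W(2)[OF that] f L] Lw[OF that] by simp
  then have "\<exists>g. coeffs_le N g \<and> f - L = (\<Prod>w\<in>W. fps_X - fps_const w) * g"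
    using W by (intro fps_value_zeros_factor F) auto
  then obtain g where g: "coeffs_le N g" "f - L = (\<Prod>w\<in>W. fps_X - fps_const w) * g" by blast
  have "fps_value (f - L) z = (\<Prod>w\<in>W. z - w) * fps_value g z"
  proof -
    have "coeffs_le 1 (\<Prod>w\<in>W. fps_X - fps_const w)" using X by (rule coeffs_le_prod_1)
    moreover have "fps_value (\<Prod>w\<in>W. fps_X - fps_const w) z = (\<Prod>w\<in>W. z - w)"
      using z by (subst fps_value_prod[OF z X]) auto
    ultimately show ?thesis using fps_value_mult[OF z _ g(1)] by (simp add: g(2))
  qed
  then have "absval (fps_value (f - L) z) \<le> (\<Prod>w\<in>W. absval (z - w)) * N"
    using absval_fps_value_le[OF z g(1)]
    by (simp add: absval_mult absval_prod mult_left_mono prod_nonneg)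
  also have "\<dots> \<le> max (B * (\<Prod>w\<in>W. absval (z - w))) (M / d)"
  proof -
    have "(\<Prod>w\<in>W. absval (z - w)) \<le> 1"
    proof (rule prod_le_1, rule conjI)
      show "absval (z - w) \<le> 1" if "w \<in> W" for w
        using W(2)[OF that] z by (intro absval_diff_le) auto
    qed simp
    then have "(\<Prod>w\<in>W. absval (z - w)) * (M / d) \<le> 1 * (M / d)"
      by (intro mult_right_mono Md)
    then show ?thesis unfolding N_def by (auto simp: max_def mult.commute)
  qed
  finally have "absval (fps_value (f - L) z + fps_value L z) \<le> max (B * (\<Prod>w\<in>W. absval (z - w))) (M / d)"
    using absval_fps_value_le[OF z L] by (intro absval_add_le) auto
  then show ?thesis using fps_value_diff[OF z f L] by simp
qed

text \<open>A factor \<open>K\<close> independent of \<open>m\<close> cannot compensate the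
  unbounded growth of \<open>(a / b) ^ m\<close> when \<open>a > b\<close>.\<close>

lemma le_if_powers_le:
  fixes a b K :: real
  assumes "\<And>m. a ^ m \<le> K * b ^ m" "0 < b"
  shows "a \<le> b"
proof (rule ccontr)
  assume "\<not> a \<le> b"
  then have "1 < a / b" using assms(2) by simp
  then obtain m where "K < (a / b) ^ m" using real_arch_pow by blast
  then have "K * b ^ m < a ^ m" using assms(2) by (simp add: power_divide pos_less_divide_eq)
  with assms(1)[of m] show False by simp
qed

section \<open>The maximum principle on the zeros and the analytic boundary\<close>

context LT_series
begin

lemma absval_le_if_le_on_zeros:
  assumes f: "coeffs_le B f" and M: "0 \<le> M" "\<And>w. w \<in> (\<Union>n. zeros n) \<Longrightarrow> absval (fps_value f w) \<le> M"
    and z: "absval z < 1"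
  shows "absval (fps_value f z) \<le> M"
proof -
  define S where "S = (SUP z\<in>open_disk. absval (fps_value f z))"
  have bdd: "bdd_above ((\<lambda>z. absval (fps_value f z)) ` open_disk)"
    using absval_fps_value_le[OF _ f] by (auto simp: open_disk_def intro!: bdd_aboveI[of _ B])
  have le_S: "absval (fps_value f z) \<le> S" if "absval z < 1" for z
    unfolding S_def using that by (intro cSUP_upper bdd) (simp add: open_disk_def)
  \<comment> \<open>Interpolation needs a coefficient bound. Replacing \<open>B\<close> by the
    supremum \<open>S\<close> itself makes the bound on the powers of \<open>f\<close> comparable
    with \<open>S\<close>.\<close>
  then have fS: "coeffs_le S f" by (rule coeffs_le_if_values_le[OF f])
  have "S \<le> M"
  proof (rule ccontr)
    assume "\<not> S \<le> M"
    then have S: "0 < S" "M / S < 1" using M by auto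
    \<comment> \<open>Interpolation at \<open>zeros m\<close> costs a factor
      \<open>1 / c ^ m\<close>, and the resulting bound should beat \<open>S ^ k\<close> by a factor
      \<open>c\<close>. The square pays for both: \<open>M ^ k / c \<le> S ^ k * c\<close>.\<close>
    obtain k where k: "(M / S) ^ k < c\<^sup>2"
      using real_arch_pow_inv[OF _ S(2), of "c\<^sup>2"] c_bounds by auto
    have "c\<^sup>2 < 1" using c_bounds by (simp add: power_less_one_iff)
    then have "0 < k" using k by (cases k) auto
    define b where "b = S ^ k * c"
    have b: "0 < b" using S c_bounds by (simp add: b_def)
    have Mb: "M ^ k / c \<le> b"
      using k S c_bounds by (simp add: b_def power_divide divide_less_eq divide_le_eq power2_eq_square mult_ac)
    have le_b: "absval (fps_value f x) ^ k \<le> b" if x: "absval x < 1" for x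
    proof -
      obtain C where C: "\<And>n. absval ((ev ^^ n) x) \<le> C * c ^ n" using iterate_decay[OF x] by blast
      show ?thesis
      proof (rule le_if_powers_le[OF _ b])
        fix m
        have z1: "absval w < 1" if "w \<in> zeros m" for w using that by (simp add: zeros_def)
        have "absval (fps_value (f ^ (k * m)) x)
            \<le> max (S ^ (k * m) * (\<Prod>w\<in>zeros m. absval (x - w))) (M ^ (k * m) / c ^ m)"
        proof (rule interpolation_bound[OF zeros_prod(1) z1])
          fix w assume w: "w \<in> zeros m"
          have "absval (fps_value f w) ^ (k * m) \<le> M ^ (k * m)"
            using w by (intro power_mono M) auto
          then show "absval (fps_value (f ^ (k * m)) w) \<le> M ^ (k * m)"
            by (simp add: fps_value_power[OF z1[OF w] f] absval_power)
        qed (use M x c_bounds zeros_separation coeffs_le_power[OF fS] in auto)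
        also have "\<dots> \<le> max C 1 * b ^ m"
        proof (rule max.boundedI)
          have "S ^ (k * m) * (\<Prod>w\<in>zeros m. absval (x - w)) \<le> S ^ (k * m) * (C * c ^ m)"
            using C[of m] S by (simp add: zeros_prod(3)[OF x])
          also have "\<dots> = C * b ^ m" by (simp add: b_def power_mult power_mult_distrib)
          also have "\<dots> \<le> max C 1 * b ^ m" using b by (intro mult_right_mono) auto
          finally show "S ^ (k * m) * (\<Prod>w\<in>zeros m. absval (x - w)) \<le> max C 1 * b ^ m" .
          have "M ^ (k * m) / c ^ m = (M ^ k / c) ^ m" by (simp add: power_mult power_divide)
          also have "\<dots> \<le> 1 * b ^ m"
            using Mb M c_bounds by (auto intro: power_mono)
          also have "\<dots> \<le> max C 1 * b ^ m" using b by (intro mult_right_mono) auto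
          finally show "M ^ (k * m) / c ^ m \<le> max C 1 * b ^ m" .
        qed
        also have "absval (fps_value (f ^ (k * m)) x) = (absval (fps_value f x) ^ k) ^ m"
          by (simp add: fps_value_power[OF x f] absval_power flip: power_mult)
        finally show "(absval (fps_value f x) ^ k) ^ m \<le> max C 1 * b ^ m" .
      qed
    qed
    \<comment> \<open>The bound \<open>b\<close> holds at all points of the disk, hence passes to
      the supremum after taking \<open>k\<close>-th roots; then \<open>S ^ k \<le> S ^ k * c\<close>
      contradicts \<open>c < 1\<close>.\<close>
    have "S \<le> root k b"
      unfolding S_def
    proof (rule cSUP_least)
      show "open_disk \<noteq> ({} :: 'a set)" by (auto simp: open_disk_def intro: exI[of _ 0])
      fix x :: 'a assume "x \<in> open_disk"
      then have "absval (fps_value f x) ^ k \<le> b" using le_b by (simp add: open_disk_def)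
      then have "root k (absval (fps_value f x) ^ k) \<le> root k b"
        using \<open>0 < k\<close> by (rule real_root_le_mono[rotated])
      then show "absval (fps_value f x) \<le> root k b"
        using \<open>0 < k\<close> by (simp add: real_root_power_cancel)
    qed
    then have "S ^ k \<le> root k b ^ k" using S by (intro power_mono) auto
    also have "\<dots> = S ^ k * c" using \<open>0 < k\<close> b by (simp add: b_def)
    also have "\<dots> < S ^ k * 1" using S c_bounds by (intro mult_strict_left_mono) auto
    finally show False by simp
  qed
  with le_S[OF z] show ?thesis by simp
qed

text \<open>The zeros form a countably infinite set with finitely many members in each smaller disk,
  so along an injective enumeration the absolute values eventually exceed every
  \<open>r < 1\<close>.\<close>

lemma zeros_enumeration:
  shows "\<exists>a :: nat \<Rightarrow> 'a. (\<Union>n. zeros n) = a ` {1..} \<and> (\<lambda>n. absval (a n)) \<longlonglongrightarrow> 1"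
proof -
  define Z where "Z = (\<Union>n. zeros n)"
  have "countable Z" unfolding Z_def by (rule countable_UN) (simp_all add: zeros_prod(1) countable_finite)
  moreover have "infinite Z" using infinite_zeros by (simp add: Z_def)
  ultimately have bij: "bij_betw (from_nat_into Z) UNIV Z" by (rule bij_betw_from_nat_into)
  \<comment> \<open>The shift adapts the enumeration from \<open>0\<close> to the index set
    \<open>{1..}\<close>; by truncated subtraction \<open>a 0 = a 1\<close>.\<close>
  define a where "a n = from_nat_into Z (n - 1)" for n
  have "(\<lambda>n. n - 1) ` {1..} = (UNIV :: nat set)"
    by (auto simp: image_iff intro!: bexI[of _ "Suc _"])
  moreover have "a ` {1..} = from_nat_into Z ` (\<lambda>n. n - 1) ` {1..}"
    unfolding image_image by (rule image_cong) (simp_all add: a_def)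
  ultimately have "a ` {1..} = Z"
    using bij by (simp add: bij_betw_def)
  moreover have "(\<lambda>n. absval (a n)) \<longlonglongrightarrow> 1"
  proof (rule LIMSEQ_imp_Suc, rule order_tendstoI)
    fix r :: real assume "r < 1"
    then have "finite (from_nat_into Z -` {z \<in> Z. absval z \<le> r})"
      using bij finite_zeros_in_smaller_disk by (intro finite_vimageI) (auto simp: Z_def bij_betw_def)
    moreover have "from_nat_into Z n \<in> Z" for n using bij by (auto simp: bij_betw_def)
    ultimately have "finite {n. \<not> r < absval (from_nat_into Z n)}"
      by (simp add: vimage_def not_less)
    then show "\<forall>\<^sub>F n in sequentially. r < absval (a (Suc n))"
      by (simp add: a_def eventually_cofinite flip: cofinite_eq_sequentially)
  next
    fix r :: real assume "1 < r"
    moreover have "absval (from_nat_into Z n) < 1" for n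
      using bij by (auto simp: bij_betw_def Z_def zeros_def)
    ultimately show "\<forall>\<^sub>F n in sequentially. absval (a (Suc n)) < r"
      by (auto simp: a_def intro!: always_eventually less_trans[of _ 1 r])
  qed
  ultimately show ?thesis unfolding Z_def by blast
qed

lemma analytic_boundary_Lambda_set: "analytic_boundary (Lambda_set P)"
  unfolding analytic_boundary_def
proof (intro conjI ballI)
  show sub: "Lambda_set P \<subseteq> open_disk" by (auto simp: Lambda_set_def)
  show "\<exists>a. Lambda_set P = a ` {1..} \<and> (\<lambda>n. absval (a n)) \<longlonglongrightarrow> 1"
    unfolding Lambda_set_eq by (rule zeros_enumeration)
  \<comment> \<open>This point makes both \<open>Lambda_set P\<close> and the disk nonempty, as the
    real suprema require.\<close>
  have "0 \<in> zeros 0" by (simp add: zeros_def)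
  then have zero: "0 \<in> Lambda_set P" unfolding Lambda_set_eq by blast
  fix f :: "'a fps" assume "f \<in> bounded_fps"
  then obtain b g where "f = fps_const b * g" "coeffs_le 1 g"
    by (auto simp: bounded_fps_def coeffs_le_1_iff)
  then have f: "coeffs_le (absval b) f"
    using coeffs_le_mult_1[OF coeffs_le_const[OF order_refl]] by blast
  have bdd: "bdd_above ((\<lambda>z. absval (fps_value f z)) ` open_disk)"
    using absval_fps_value_le[OF _ f] by (auto simp: open_disk_def intro!: bdd_aboveI[of _ "absval b"])
  then have bdd': "bdd_above ((\<lambda>z. absval (fps_value f z)) ` Lambda_set P)"
    using sub by (rule bdd_above_mono[OF _ image_mono])
  have upper: "absval (fps_value f w) \<le> sup_norm_on (Lambda_set P) f" if "w \<in> Lambda_set P" for w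
    unfolding sup_norm_on_def using that by (intro cSUP_upper bdd')
  show "sup_norm_on open_disk f = sup_norm_on (Lambda_set P) f"
  proof (rule antisym)
    show "sup_norm_on (Lambda_set P) f \<le> sup_norm_on open_disk f"
      unfolding sup_norm_on_def using zero sub bdd by (intro cSUP_subset_mono) auto
    have "absval (fps_value f z) \<le> sup_norm_on (Lambda_set P) f" if "absval z < 1" for z
    proof (rule absval_le_if_le_on_zeros[OF f _ _ that])
      show "0 \<le> sup_norm_on (Lambda_set P) f"
        using upper[OF zero] absval_nonneg order_trans by blast
    qed (use upper Lambda_set_eq in auto)
    then show "sup_norm_on open_disk f \<le> sup_norm_on (Lambda_set P) f"
      unfolding sup_norm_on_def[of open_disk] using zero sub
      by (intro cSUP_least) (auto simp: open_disk_def)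
  qed
qed

end

theorem theoremA:
  fixes p q h :: nat and P :: "'a::nonarch_field fps"
  assumes "prime p"
    and "is_Cp p TYPE('a)"
    and "q = p ^ h"
    and "LT_like p q P"
  shows "analytic_boundary (Lambda_set P)"
proof -
  interpret LT_series p "TYPE('a)" q h P
    using assms by unfold_locales
  show ?thesis by (rule analytic_boundary_Lambda_set)
qed

end
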